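(* Let $T>0$, let $p\ge2$ be an even integer, let $\alpha\in(0,1)$ with $\alpha>\frac{(1+\frac4p)^{1/2}-1}{2}$, let $\pi=(\pi_n)_{n\ge1}$ be a sequence of partitions of $[0,T]$ with mesh size going to zero, and let $S\in V_p(\pi)\cap C^\alpha([0,T],\mathbb R)$. Let $F\in\mathbb C^{1,2}_b(\Lambda_T)$ be such that $\nabla_\omega F\in\mathbb C^{1,1}_b(\Lambda_T)$, and assume furthermore that $F$ is Lipschitz-continuous with respect to $d_\infty$. Then the path $F(\cdot,S):t\mapsto F(t,S_t)$ belongs to $V_p(\pi)$ and for all $t\in[0,T]$ $$[F(\cdot,S)]^p(t)=\int_0^t|\nabla_\omega F(s,S_s)|^p\,d[S]^p(s).$$
   Context: $C^\alpha([0,T],\mathbb R)$ is the space of $\alpha$-Hölder continuous paths. Partitions: each $\pi_n=\{0=t^n_0<t^n_1<\dots<t^n_{N(\pi_n)}=T\}$ is finite; $[t_j,t_{j+1}]\in\pi_n$ means that $t_j<t_{j+1}$ are consecutive points of $\pi_n$. $\operatorname{osc}(S,\pi_n):=\max_{[t_j,t_{j+1}]\in\pi_n}\max_{r,s\in[t_j,t_{j+1}]}|S(s)-S(r)|$. A path $S\in C([0,T],\mathbb R)$ belongs to $V_p(\pi)$ if $\operatorname{osc}(S,\pi_n)\to0$ and the measures $\sum_{[t_j,t_{j+1}]\in\pi_n}\delta(\cdot-t_j)|S(t_{j+1})-S(t_j)|^p$ converge weakly to a measure $\mu$ on $[0,T]$ without atoms; then $[S]^p(t):=\mu([0,t])$.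 Functionals: $D([0,T],\mathbb R)$ is the space of càdlàg paths; $\omega_t(s)=\omega(s\wedge t)$ is the path stopped at $t$. $\Lambda_T=\{(t,\omega_t):(t,\omega)\in[0,T]\times D([0,T],\mathbb R)\}$ with metric $d_\infty((t,\omega),(t',\omega'))=\sup_{s\in[0,T]}|\omega(s\wedge t)-\omega'(s\wedge t')|+|t-t'|$. A non-anticipative functional is a map $F:\Lambda_T\to\mathbb R$; one writes $F(t,\omega)=F(t,\omega_t)$ for $\omega\in D([0,T],\mathbb R)$. (i) $F\in\mathbb C^{0,0}_l(\Lambda_T)$ if for all $t\in[0,T]$ the map $F(t,\cdot):D([0,T],\mathbb R)\to\mathbb R$ is continuous (sup norm) and for all $(t,\omega)\in\Lambda_T$ and $\varepsilon>0$ there is $\delta>0$ such that $|F(t,\omega)-F(t',\omega')|<\varepsilon$ for all $(t',\omega')\in\Lambda_T$ with $t'<t$ and $d_\infty((t,\omega),(t',\omega'))<\delta$. (ii) $F\in\mathbb B(\Lambda_T)$ if for every $t_0\in[0,T)$ and $K>0$ there is $C_{K,t_0}>0$ such that $|F(t,\omega)|\le C_{K,t_0}$ for all $t\in[0,t_0]$ and all $\omega\in D([0,T],\mathbb R)$ with $\sup_{s\in[0,t]}|\omega(s)|\le K$. (iii) The horizontal derivative is $\mathcal DF(t,\omega)=\lim_{h\downarrow0}\frac{F(t+h,\omega_t)-F(t,\omega_t)}h$ (for $t<T$; at $t=T$ it is understood as $\lim_{t\uparrow T}\mathcal DF(t,\omega_t)$). (iv) The vertical derivative is $\nabla_\omega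 F(t,\omega)=\lim_{h\downarrow0}\frac{F(t,\omega_t+h\mathbf 1_{[t,T]})-F(t,\omega_t)}h$, and $\nabla^{k+1}_\omega F=\nabla_\omega\nabla^k_\omega F$. (v) For $m\in\mathbb N_0$, $F\in\mathbb C^{1,m}_b(\Lambda_T)$ if $F$ is horizontally differentiable and $m$ times vertically differentiable at every $(t,\omega)\in\Lambda_T$, and $F,\mathcal DF,\nabla^k_\omega F\in\mathbb C^{0,0}_l(\Lambda_T)\cap\mathbb B(\Lambda_T)$ for $k=1,\dots,m$. *)

theory Defs
  imports "HOL-Analysis.Analysis"
begin

section \<open>Partitions and $p$-th variation\<close>

text \<open>A partition is encoded by its finite set of points, and \<open>ivals P\<close> is the set of pairs of
  consecutive points of \<open>P\<close>.\<close>

definition partition_of :: "real \<Rightarrow> real set \<Rightarrow> bool" where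
  "partition_of T P \<longleftrightarrow> finite P \<and> 0 \<in> P \<and> T \<in> P \<and> P \<subseteq> {0..T}"

definition ivals :: "real set \<Rightarrow> (real \<times> real) set" where
  "ivals P = {(u, v). u \<in> P \<and> v \<in> P \<and> u < v \<and> P \<inter> {u<..<v} = {}}"

definition mesh :: "real set \<Rightarrow> real" where
  "mesh P = (MAX (u, v)\<in>ivals P. v - u)"

definition osc :: "(real \<Rightarrow> real) \<Rightarrow> real set \<Rightarrow> real" where
  "osc S P = (MAX (u, v)\<in>ivals P. SUP (r, s)\<in>{u..v} \<times> {u..v}. \<bar>S s - S r\<bar>)"

text \<open>The Borel space of $[0,T]$, and the measure
  $\sum_{[t_j,t_{j+1}]} \delta_{t_j} |S(t_{j+1})-S(t_j)|^p$ on it, written as the image under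
  $(t_j,t_{j+1}) \mapsto t_j$ of a weighted counting measure on the partition intervals.\<close>

abbreviation borel_upto :: "real \<Rightarrow> real measure" where
  "borel_upto T \<equiv> restrict_space borel {0..T}"

definition increment_measure ::
    "real \<Rightarrow> nat \<Rightarrow> (real \<Rightarrow> real) \<Rightarrow> real set \<Rightarrow> real measure" where
  "increment_measure T p S P =
     distr (point_measure (ivals P) (\<lambda>(u, v). ennreal (\<bar>S v - S u\<bar> ^ p))) (borel_upto T) fst"

definition weakly_converges_on :: "real \<Rightarrow> (nat \<Rightarrow> real measure) \<Rightarrow> real measure \<Rightarrow> bool" where
  "weakly_converges_on T M \<mu> \<longleftrightarrow>
     (\<forall>f :: real \<Rightarrow> real. continuous_on {0..T} f \<longrightarrow>
        (\<lambda>n. integral\<^sup>L (M n) f) \<longlonglongrightarrow> integral\<^sup>L \<mu> f)"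

definition is_pvar_measure ::
    "real \<Rightarrow> (nat \<Rightarrow> real set) \<Rightarrow> nat \<Rightarrow> (real \<Rightarrow> real) \<Rightarrow> real measure \<Rightarrow> bool" where
  "is_pvar_measure T \<pi> p S \<mu> \<longleftrightarrow>
     sets \<mu> = sets (borel_upto T) \<and> finite_measure \<mu> \<and>
     (\<forall>x\<in>{0..T}. emeasure \<mu> {x} = 0) \<and>
     weakly_converges_on T (\<lambda>n. increment_measure T p S (\<pi> n)) \<mu>"

definition Vp :: "real \<Rightarrow> (nat \<Rightarrow> real set) \<Rightarrow> nat \<Rightarrow> (real \<Rightarrow> real) set" where
  "Vp T \<pi> p = {S. continuous_on {0..T} S \<and> (\<lambda>n. osc S (\<pi> n)) \<longlonglongrightarrow> 0 \<and>
                  (\<exists>\<mu>. is_pvar_measure T \<pi> p S \<mu>)}"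

text \<open>The limit measure is unique, because finite Borel measures on $[0,T]$ are determined by
  the integrals of continuous functions.\<close>

definition pvar_measure ::
    "real \<Rightarrow> (nat \<Rightarrow> real set) \<Rightarrow> nat \<Rightarrow> (real \<Rightarrow> real) \<Rightarrow> real measure" where
  "pvar_measure T \<pi> p S = (THE \<mu>. is_pvar_measure T \<pi> p S \<mu>)"

definition pvar ::
    "real \<Rightarrow> (nat \<Rightarrow> real set) \<Rightarrow> nat \<Rightarrow> (real \<Rightarrow> real) \<Rightarrow> real \<Rightarrow> real" where
  "pvar T \<pi> p S t = measure (pvar_measure T \<pi> p S) {0..t}"

definition holder_paths :: "real \<Rightarrow> real \<Rightarrow> (real \<Rightarrow> real) set" where
  "holder_paths T \<alpha> =
     {S. \<exists>C. \<forall>s\<in>{0..T}. \<forall>t\<in>{0..T}. \<bar>S s - S t\<bar> \<le> C * \<bar>s - t\<bar> powr \<alpha>}"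


section \<open>Non-anticipative functionals\<close>

text \<open>Paths on $[0,T]$ are made unique as functions on the real line by taking the value
  \<open>undefined\<close> off $[0,T]$.\<close>

definition cadlag_paths :: "real \<Rightarrow> (real \<Rightarrow> real) set" where
  "cadlag_paths T = {\<omega> \<in> extensional {0..T}.
     (\<forall>t\<in>{0..<T}. (\<omega> \<longlongrightarrow> \<omega> t) (at_right t)) \<and>
     (\<forall>t\<in>{0<..T}. \<exists>l. (\<omega> \<longlongrightarrow> l) (at_left t))}"

definition stopped :: "real \<Rightarrow> real \<Rightarrow> (real \<Rightarrow> real) \<Rightarrow> real \<Rightarrow> real" where
  "stopped T t \<omega> = (\<lambda>s\<in>{0..T}. \<omega> (min s t))"

definition Lambda :: "real \<Rightarrow> (real \<times> (real \<Rightarrow> real)) set" where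
  "Lambda T = {(t, stopped T t \<omega>) | t \<omega>. t \<in> {0..T} \<and> \<omega> \<in> cadlag_paths T}"

definition sup_dist :: "real \<Rightarrow> (real \<Rightarrow> real) \<Rightarrow> (real \<Rightarrow> real) \<Rightarrow> real" where
  "sup_dist T \<omega> \<omega>' = (SUP s\<in>{0..T}. \<bar>\<omega> s - \<omega>' s\<bar>)"

definition d_inf ::
    "real \<Rightarrow> real \<times> (real \<Rightarrow> real) \<Rightarrow> real \<times> (real \<Rightarrow> real) \<Rightarrow> real" where
  "d_inf T = (\<lambda>(t, \<omega>) (t', \<omega>').
     (SUP s\<in>{0..T}. \<bar>\<omega> (min s t) - \<omega>' (min s t')\<bar>) + \<bar>t - t'\<bar>)"

text \<open>A functional on \<open>Lambda T\<close> is represented by a function of \<open>t\<close> and \<open>\<omega>\<close> of which only the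
  values on \<open>Lambda T\<close> are ever used: for a general path the convention
  $F(t,\omega) = F(t,\omega_t)$ is written out as \<open>F t (stopped T t \<omega>)\<close>.\<close>

type_synonym functional = "real \<Rightarrow> (real \<Rightarrow> real) \<Rightarrow> real"

definition C00l :: "real \<Rightarrow> functional set" where
  "C00l T = {F.
     (\<forall>t\<in>{0..T}. \<forall>\<omega>\<in>cadlag_paths T. \<forall>\<epsilon>>0. \<exists>\<delta>>0. \<forall>\<omega>'\<in>cadlag_paths T.
        sup_dist T \<omega> \<omega>' < \<delta> \<longrightarrow> \<bar>F t (stopped T t \<omega>) - F t (stopped T t \<omega>')\<bar> < \<epsilon>) \<and>
     (\<forall>(t, \<omega>)\<in>Lambda T. \<forall>\<epsilon>>0. \<exists>\<delta>>0. \<forall>(t', \<omega>')\<in>Lambda T.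
        t' < t \<and> d_inf T (t, \<omega>) (t', \<omega>') < \<delta> \<longrightarrow> \<bar>F t \<omega> - F t' \<omega>'\<bar> < \<epsilon>)}"

definition boundedness_preserving :: "real \<Rightarrow> functional set" where
  "boundedness_preserving T = {F.
     \<forall>t0\<in>{0..<T}. \<forall>K>0. \<exists>C>0. \<forall>t\<in>{0..t0}. \<forall>\<omega>\<in>cadlag_paths T.
       (\<forall>s\<in>{0..t}. \<bar>\<omega> s\<bar> \<le> K) \<longrightarrow> \<bar>F t (stopped T t \<omega>)\<bar> \<le> C}"

definition hquot :: "real \<Rightarrow> functional \<Rightarrow> real \<Rightarrow> (real \<Rightarrow> real) \<Rightarrow> real \<Rightarrow> real" where
  "hquot T F t \<omega> h = (F (t + h) (stopped T t \<omega>) - F t (stopped T t \<omega>)) / h"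

definition hderiv :: "real \<Rightarrow> functional \<Rightarrow> functional" where
  "hderiv T F t \<omega> =
     (if t < T then Lim (at_right 0) (hquot T F t \<omega>)
      else Lim (at_left T) (\<lambda>s. Lim (at_right 0) (hquot T F s \<omega>)))"

definition horizontally_differentiable :: "real \<Rightarrow> functional \<Rightarrow> bool" where
  "horizontally_differentiable T F \<longleftrightarrow>
     (\<forall>t\<in>{0..<T}. \<forall>\<omega>\<in>cadlag_paths T. \<exists>l. (hquot T F t \<omega> \<longlongrightarrow> l) (at_right 0)) \<and>
     (\<forall>\<omega>\<in>cadlag_paths T. \<exists>l. ((\<lambda>s. hderiv T F s (stopped T s \<omega>)) \<longlongrightarrow> l) (at_left T))"

definition bumped :: "real \<Rightarrow> real \<Rightarrow> real \<Rightarrow> (real \<Rightarrow> real) \<Rightarrow> real \<Rightarrow> real" where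
  "bumped T t h \<omega> = (\<lambda>s\<in>{0..T}. stopped T t \<omega> s + h * indicator {t..T} s)"

definition vquot :: "real \<Rightarrow> functional \<Rightarrow> real \<Rightarrow> (real \<Rightarrow> real) \<Rightarrow> real \<Rightarrow> real" where
  "vquot T F t \<omega> h = (F t (bumped T t h \<omega>) - F t (stopped T t \<omega>)) / h"

definition vderiv :: "real \<Rightarrow> functional \<Rightarrow> functional" where
  "vderiv T F t \<omega> = Lim (at_right 0) (vquot T F t \<omega>)"

definition vertically_differentiable :: "real \<Rightarrow> functional \<Rightarrow> bool" where
  "vertically_differentiable T F \<longleftrightarrow>
     (\<forall>t\<in>{0..T}. \<forall>\<omega>\<in>cadlag_paths T. \<exists>l. (vquot T F t \<omega> \<longlongrightarrow> l) (at_right 0))"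

definition C1b :: "real \<Rightarrow> nat \<Rightarrow> functional set" where
  "C1b T m = {F.
     horizontally_differentiable T F \<and>
     (\<forall>k<m. vertically_differentiable T ((vderiv T ^^ k) F)) \<and>
     F \<in> C00l T \<inter> boundedness_preserving T \<and>
     hderiv T F \<in> C00l T \<inter> boundedness_preserving T \<and>
     (\<forall>k\<in>{1..m}. (vderiv T ^^ k) F \<in> C00l T \<inter> boundedness_preserving T)}"

definition d_inf_lipschitz :: "real \<Rightarrow> functional \<Rightarrow> bool" where
  "d_inf_lipschitz T F \<longleftrightarrow>
     (\<exists>L\<ge>0. \<forall>(t, \<omega>)\<in>Lambda T. \<forall>(t', \<omega>')\<in>Lambda T.
        \<bar>F t \<omega> - F t' \<omega>'\<bar> \<le> L * d_inf T (t, \<omega>) (t', \<omega>'))"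

end

theory Submission
  imports Defs "HOL-Probability.Distribution_Functions"
begin

text \<open>Write \<open>f t = F(t, S_t)\<close> and \<open>g t = \<nabla>F(t, S_t)\<close>. Approximating \<open>S\<close> on \<open>[s, t]\<close> by a staircase
  and expanding \<open>F\<close> along its steps gives
  \<open>f t - f s = g s * (S t - S s) + O((t - s) powr \<beta>)\<close> with \<open>\<beta> = min 1 (\<alpha> + \<alpha>\<^sup>2)\<close>; the lower bound on
  \<open>\<alpha>\<close> says precisely that \<open>(\<alpha> + \<alpha>\<^sup>2) * p > 1\<close>, so the \<open>p\<close>-th powers of the remainders sum to
  something negligible. Hence the increment measures of \<open>f\<close> have the same limit as the ones of \<open>S\<close>
  weighted with \<open>\<bar>g\<bar>^p\<close>. As \<open>g\<close> is continuous, by interpolation between the Lipschitz bound on \<open>F\<close>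
  and the bound on its second vertical derivative, that limit is \<open>\<bar>g\<bar>^p d[S]^p\<close>.\<close>

section \<open>Calculus of non-anticipative functionals\<close>

text \<open>Both derivatives are limits from the right, while in time the functionals are only
  left-continuous. These are the two hypotheses of \<open>right_derivative_le\<close>, which
  replaces the mean value theorem wherever a bound on a derivative is turned into a bound on an
  increment. The derivatives say nothing about moving along \<open>S\<close> itself: they describe a
  path frozen while time runs, and a jump at a fixed time. A staircase consists of exactly these two
  kinds of moves. The Lipschitz hypothesis then exchanges the finished staircase for
  \<open>S\<close> at a cost paid once and not per step. The bounds on the derivatives of
  \<open>G\<close> are available only for paths uniformly close to \<open>S\<close>. Hence all
  staircases and bumps are kept in a tube around \<open>S\<close>, and the expansion is claimed only
  for short intervals. For the limit of the \<open>p\<close>-th powers the remainder has to be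
  separated from the main term inside a power. A pointwise inequality with a free parameter does
  this, and the weight \<open>\<bar>g\<bar>^p\<close> is then absorbed into the test
  function.\<close>

text \<open>Take a line through \<open>(a, \<phi> a)\<close> of slope \<open>D > C\<close> and the
  supremum \<open>c\<close> of the points where \<open>\<phi>\<close> is not above it.
  Left-continuity puts \<open>c\<close> itself into this set; the right derivative at
  \<open>c\<close> would then produce further such points beyond \<open>c\<close>, unless
  \<open>c = b\<close>.\<close>

lemma right_derivative_le:
  fixes \<phi> :: "real \<Rightarrow> real"
  assumes "a \<le> b"
    and left: "\<And>x. a < x \<Longrightarrow> x \<le> b \<Longrightarrow> (\<phi> \<longlongrightarrow> \<phi> x) (at_left x)"
    and right: "\<And>x. a \<le> x \<Longrightarrow> x < b \<Longrightarrow>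
      \<exists>l\<le>C. ((\<lambda>h. (\<phi> (x + h) - \<phi> x) / h) \<longlongrightarrow> l) (at_right 0)"
  shows "\<phi> b - \<phi> a \<le> C * (b - a)"
proof (rule ccontr)
  assume "\<not> \<phi> b - \<phi> a \<le> C * (b - a)"
  then have gt: "\<phi> b - \<phi> a > C * (b - a)" by simp
  then have "a < b" using \<open>a \<le> b\<close> by (cases "a = b") auto
  have "C < (\<phi> b - \<phi> a) / (b - a)"
    using gt \<open>a < b\<close> by (simp add: field_simps)
  \<comment> \<open>The strict gap \<open>C < D\<close> makes the difference quotients at
    \<open>c\<close> eventually smaller than \<open>D\<close>, although their limit may equal
    \<open>C\<close>.\<close>
  then obtain D where "C < D" "D < (\<phi> b - \<phi> a) / (b - a)" using dense by blast
  define \<psi> where "\<psi> x = \<phi> x - \<phi> a - D * (x - a)" for x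
  have "\<psi> b > 0"
    using \<open>D < _\<close> \<open>a < b\<close> by (simp add: \<psi>_def field_simps)
  define A where "A = {x \<in> {a..b}. \<psi> x \<le> 0}"
  define c where "c = Sup A"
  have "a \<in> A" using \<open>a < b\<close> by (simp add: A_def \<psi>_def)
  have bdd: "bdd_above A" by (rule bdd_aboveI[of _ b]) (auto simp: A_def)
  have "a \<le> c" unfolding c_def by (rule cSup_upper[OF \<open>a \<in> A\<close> bdd])
  have "c \<le> b" unfolding c_def by (rule cSup_least) (use \<open>a \<in> A\<close> in \<open>auto simp: A_def\<close>)
  have "\<psi> c \<le> 0"
  proof (rule ccontr)
    assume "\<not> \<psi> c \<le> 0"
    then have "\<psi> c > 0" by simp
    then have "a < c" using \<open>a \<le> c\<close> \<open>a \<in> A\<close> by (cases "a = c") (auto simp: A_def)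
    have "(\<psi> \<longlongrightarrow> \<psi> c) (at_left c)"
      unfolding \<psi>_def by (intro tendsto_intros left \<open>a < c\<close> \<open>c \<le> b\<close>)
    then have "\<forall>\<^sub>F x in at_left c. \<psi> x > 0"
      using \<open>\<psi> c > 0\<close> by (rule order_tendstoD(1))
    then obtain d where "d < c" and d: "\<And>y. d < y \<Longrightarrow> y < c \<Longrightarrow> \<psi> y > 0"
      unfolding eventually_at_left[OF \<open>a < c\<close>] by auto
    have "A \<noteq> {}" using \<open>a \<in> A\<close> by auto
    then obtain x where "x \<in> A" "d < x"
      using less_cSupD \<open>d < c\<close> unfolding c_def by metis
    moreover have "x \<le> c" unfolding c_def by (rule cSup_upper[OF \<open>x \<in> A\<close> bdd])
    moreover have "x \<noteq> c" using \<open>\<psi> c > 0\<close> \<open>x \<in> A\<close> by (auto simp: A_def)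
    ultimately show False using d[of x] by (auto simp: A_def)
  qed
  with \<open>\<psi> b > 0\<close> \<open>c \<le> b\<close> have "c < b" by (cases "c = b") auto
  obtain l where "l \<le> C" and l: "((\<lambda>h. (\<phi> (c + h) - \<phi> c) / h) \<longlongrightarrow> l) (at_right 0)"
    using right[OF \<open>a \<le> c\<close> \<open>c < b\<close>] by blast
  have "\<forall>\<^sub>F h in at_right 0. (\<phi> (c + h) - \<phi> c) / h < D"
    using \<open>l \<le> C\<close> \<open>C < D\<close> by (intro order_tendstoD(2)[OF l]) auto
  moreover have "\<forall>\<^sub>F h in at_right 0. h < b - c"
    using \<open>c < b\<close> by (intro eventually_at_rightI[of 0 "b - c"]) auto
  ultimately have "\<forall>\<^sub>F h in at_right 0. (\<phi> (c + h) - \<phi> c) / h < D \<and> h < b - c \<and> 0 < h"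
    using eventually_at_right_less[of 0] by eventually_elim auto
  then obtain h where h: "(\<phi> (c + h) - \<phi> c) / h < D" "h < b - c" "0 < h"
    using eventually_happens'[OF trivial_limit_at_right_real] by blast
  then have "\<phi> (c + h) - \<phi> c < D * h" by (simp add: field_simps)
  then have "\<psi> (c + h) \<le> 0" using \<open>\<psi> c \<le> 0\<close> by (simp add: \<psi>_def algebra_simps)
  then have "c + h \<in> A" using h \<open>a \<le> c\<close> by (auto simp: A_def)
  then have "c + h \<le> c" unfolding c_def by (rule cSup_upper[OF _ bdd])
  then show False using h by simp
qed

text \<open>Applied to \<open>\<phi>\<close> and \<open>- \<phi>\<close>. Splitting off the slope
  \<open>c\<close> lets one statement serve plain increments (\<open>c = 0\<close>) and first-order
  expansions alike.\<close>

lemma right_derivative_bound: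
  fixes \<phi> :: "real \<Rightarrow> real"
  assumes "a \<le> b"
    and left: "\<And>x. a < x \<Longrightarrow> x \<le> b \<Longrightarrow> (\<phi> \<longlongrightarrow> \<phi> x) (at_left x)"
    and right: "\<And>x. a \<le> x \<Longrightarrow> x < b \<Longrightarrow>
      \<exists>l. \<bar>l - c\<bar> \<le> C \<and> ((\<lambda>h. (\<phi> (x + h) - \<phi> x) / h) \<longlongrightarrow> l) (at_right 0)"
  shows "\<bar>\<phi> b - \<phi> a - c * (b - a)\<bar> \<le> C * (b - a)"
proof -
  have "\<phi> b - \<phi> a \<le> (c + C) * (b - a)"
  proof (rule right_derivative_le[OF \<open>a \<le> b\<close> left])
    fix x assume "a \<le> x" "x < b"
    from right[OF this] obtain l where "\<bar>l - c\<bar> \<le> C"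
      "((\<lambda>h. (\<phi> (x + h) - \<phi> x) / h) \<longlongrightarrow> l) (at_right 0)" by blast
    then show "\<exists>l\<le>c + C. ((\<lambda>h. (\<phi> (x + h) - \<phi> x) / h) \<longlongrightarrow> l) (at_right 0)"
      by (intro exI[of _ l]) auto
  qed
  moreover have "- \<phi> b - - \<phi> a \<le> (C - c) * (b - a)"
  proof (rule right_derivative_le[OF \<open>a \<le> b\<close>])
    fix x assume "a < x" "x \<le> b"
    then show "((\<lambda>x. - \<phi> x) \<longlongrightarrow> - \<phi> x) (at_left x)" by (intro tendsto_minus left)
  next
    fix x assume "a \<le> x" "x < b"
    from right[OF this] obtain l where l: "\<bar>l - c\<bar> \<le> C"
      "((\<lambda>h. (\<phi> (x + h) - \<phi> x) / h) \<longlongrightarrow> l) (at_right 0)" by blast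
    have "((\<lambda>h. (- \<phi> (x + h) - - \<phi> x) / h) \<longlongrightarrow> - l) (at_right 0)"
      using tendsto_minus[OF l(2)] by (simp add: minus_divide_left)
    then show "\<exists>l\<le>C - c. ((\<lambda>h. (- \<phi> (x + h) - - \<phi> x) / h) \<longlongrightarrow> l) (at_right 0)"
      using l(1) by (intro exI[of _ "- l"]) auto
  qed
  ultimately show ?thesis by (simp add: abs_le_iff algebra_simps)
qed

section \<open>Stopped and bumped paths\<close>

lemma stopped_apply: "r \<in> {0..T} \<Longrightarrow> stopped T t \<omega> r = \<omega> (min r t)"
  by (simp add: stopped_def)

lemma bumped_apply:
  "r \<in> {0..T} \<Longrightarrow> bumped T t h \<omega> r = (if r < t then \<omega> r else \<omega> t + h)"
  by (auto simp: bumped_def stopped_def min_def)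

lemma stopped_eq_bumped: "stopped T t \<omega> = bumped T t 0 \<omega>"
  by (auto simp: bumped_def stopped_def restrict_def)

lemma stopped_cong:
  assumes "0 \<le> t" and "\<And>r. r \<in> {0..t} \<Longrightarrow> \<omega> r = \<omega>' r"
  shows "stopped T t \<omega> = stopped T t \<omega>'"
  using assms by (auto simp: stopped_def fun_eq_iff restrict_def)

text \<open>Bumps at a fixed time form a one-parameter family. Thus the vertical derivative at
  \<open>bumped T t h \<omega>\<close> is the right derivative at \<open>h\<close> of the real
  function \<open>\<lambda>h. H t (bumped T t h \<omega>)\<close>.\<close>

lemma bumped_bumped:
  assumes "t \<in> {0..T}"
  shows "bumped T t k (bumped T t h \<omega>) = bumped T t (h + k) \<omega>"
  using assms by (auto simp: bumped_def stopped_def restrict_def fun_eq_iff min_def indicator_def)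

lemma stopped_bumped:
  assumes "t \<in> {0..T}"
  shows "stopped T t (bumped T t h \<omega>) = bumped T t h \<omega>"
  using bumped_bumped[OF assms, of 0 h \<omega>] by (simp add: stopped_eq_bumped)

lemma stopped_stopped:
  assumes "s \<in> {0..T}" "t \<in> {0..T}"
  shows "stopped T t (stopped T s \<omega>) = stopped T (min s t) \<omega>"
  using assms by (auto simp: stopped_def restrict_def fun_eq_iff min_def)

lemma bumped_cadlag:
  assumes "\<omega> \<in> cadlag_paths T" and "t \<in> {0..T}"
  shows "bumped T t h \<omega> \<in> cadlag_paths T"
  unfolding cadlag_paths_def
proof (intro CollectI conjI ballI)
  show "bumped T t h \<omega> \<in> extensional {0..T}" by (simp add: bumped_def)
next
  fix r assume r: "r \<in> {0..<T}"
  show "(bumped T t h \<omega> \<longlongrightarrow> bumped T t h \<omega> r) (at_right r)"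
  proof (cases "r < t")
    case True
    have "(\<omega> \<longlongrightarrow> \<omega> r) (at_right r)" using assms r by (auto simp: cadlag_paths_def)
    moreover have "\<forall>\<^sub>F x in at_right r. bumped T t h \<omega> x = \<omega> x"
      using True assms r by (intro eventually_at_rightI[of r t]) (auto simp: bumped_apply)
    ultimately have "(bumped T t h \<omega> \<longlongrightarrow> \<omega> r) (at_right r)"
      using tendsto_cong by blast
    then show ?thesis using True r by (simp add: bumped_apply)
  next
    case False
    have "\<forall>\<^sub>F x in at_right r. bumped T t h \<omega> x = bumped T t h \<omega> r"
      using False assms r by (intro eventually_at_rightI[of r T]) (auto simp: bumped_apply)
    then show ?thesis by (rule tendsto_eventually)
  qed
next
  fix r assume r: "r \<in> {0<..T}"
  show "\<exists>l. (bumped T t h \<omega> \<longlongrightarrow> l) (at_left r)"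
  proof (cases "r \<le> t")
    case True
    obtain l where "(\<omega> \<longlongrightarrow> l) (at_left r)" using assms(1) r by (force simp: cadlag_paths_def)
    moreover have "\<forall>\<^sub>F x in at_left r. bumped T t h \<omega> x = \<omega> x"
      using True assms r by (intro eventually_at_leftI[of 0 r]) (auto simp: bumped_apply)
    ultimately show ?thesis using tendsto_cong by blast
  next
    case False
    have "\<forall>\<^sub>F x in at_left r. bumped T t h \<omega> x = \<omega> t + h"
      using False assms r by (intro eventually_at_leftI[of t r]) (auto simp: bumped_apply)
    then show ?thesis using tendsto_eventually by blast
  qed
qed

lemma stopped_cadlag:
  "\<omega> \<in> cadlag_paths T \<Longrightarrow> t \<in> {0..T} \<Longrightarrow> stopped T t \<omega> \<in> cadlag_paths T"
  by (simp add: stopped_eq_bumped bumped_cadlag)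

lemma continuous_cadlag:
  assumes "continuous_on {0..T} S"
  shows "restrict S {0..T} \<in> cadlag_paths T"
  unfolding cadlag_paths_def
proof (intro CollectI conjI ballI)
  fix r assume r: "r \<in> {0..<T}"
  have "(S \<longlongrightarrow> S r) (at r within {0..T})" using assms r by (auto simp: continuous_on_def)
  then have "(S \<longlongrightarrow> S r) (at r within {r..T})" by (rule tendsto_within_subset) (use r in auto)
  then have "(S \<longlongrightarrow> S r) (at_right r)" using r by (simp add: at_within_Icc_at_right)
  moreover have "\<forall>\<^sub>F x in at_right r. S x = restrict S {0..T} x"
    using r by (intro eventually_at_rightI[of r T]) auto
  ultimately have "(restrict S {0..T} \<longlongrightarrow> S r) (at_right r)" using tendsto_cong by blast
  then show "(restrict S {0..T} \<longlongrightarrow> restrict S {0..T} r) (at_right r)" using r by simp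
next
  fix r assume r: "r \<in> {0<..T}"
  have "(S \<longlongrightarrow> S r) (at r within {0..T})" using assms r by (auto simp: continuous_on_def)
  then have "(S \<longlongrightarrow> S r) (at r within {0..r})" by (rule tendsto_within_subset) (use r in auto)
  then have "(S \<longlongrightarrow> S r) (at_left r)" using r by (simp add: at_within_Icc_at_left)
  moreover have "\<forall>\<^sub>F x in at_left r. S x = restrict S {0..T} x"
    using r by (intro eventually_at_leftI[of 0 r]) auto
  ultimately show "\<exists>l. (restrict S {0..T} \<longlongrightarrow> l) (at_left r)" using tendsto_cong by blast
qed simp

lemma d_inf_stopped_le:
  assumes "t \<in> {0..T}" "t' \<in> {0..T}"
    and "\<And>r. r \<in> {0..T} \<Longrightarrow> \<bar>\<omega> (min r t) - \<omega>' (min r t')\<bar> \<le> D"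
  shows "d_inf T (t, stopped T t \<omega>) (t', stopped T t' \<omega>') \<le> D + \<bar>t - t'\<bar>"
proof -
  have "(SUP s\<in>{0..T}. \<bar>stopped T t \<omega> (min s t) - stopped T t' \<omega>' (min s t')\<bar>) \<le> D"
    using assms by (intro cSUP_least) (auto simp: stopped_apply)
  then show ?thesis by (simp add: d_inf_def)
qed

lemma stopped_in_Lambda:
  "\<omega> \<in> cadlag_paths T \<Longrightarrow> t \<in> {0..T} \<Longrightarrow> (t, stopped T t \<omega>) \<in> Lambda T"
  by (auto simp: Lambda_def)

section \<open>Increments along horizontal and vertical moves\<close>

lemma C00l_continuous:
  assumes "H \<in> C00l T" "t \<in> {0..T}" "\<omega> \<in> cadlag_paths T" "\<epsilon> > 0"
  obtains \<delta> where "\<delta> > 0"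
    "\<And>\<omega>'. \<omega>' \<in> cadlag_paths T \<Longrightarrow> sup_dist T \<omega> \<omega>' < \<delta> \<Longrightarrow>
      \<bar>H t (stopped T t \<omega>) - H t (stopped T t \<omega>')\<bar> < \<epsilon>"
  using assms unfolding C00l_def by blast

lemma C00l_left:
  assumes "H \<in> C00l T" "(t, \<omega>) \<in> Lambda T" "\<epsilon> > 0"
  obtains \<delta> where "\<delta> > 0"
    "\<And>t' \<omega>'. (t', \<omega>') \<in> Lambda T \<Longrightarrow> t' < t \<Longrightarrow> d_inf T (t, \<omega>) (t', \<omega>') < \<delta> \<Longrightarrow>
      \<bar>H t \<omega> - H t' \<omega>'\<bar> < \<epsilon>"
proof -
  from assms(1) have *: "\<forall>(t, \<omega>)\<in>Lambda T. \<forall>\<epsilon>>0. \<exists>\<delta>>0. \<forall>(t', \<omega>')\<in>Lambda T.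
      t' < t \<and> d_inf T (t, \<omega>) (t', \<omega>') < \<delta> \<longrightarrow> \<bar>H t \<omega> - H t' \<omega>'\<bar> < \<epsilon>"
    by (simp add: C00l_def)
  from bspec[OF * assms(2)] assms(3) obtain \<delta> where "\<delta> > 0" "\<forall>(t', \<omega>')\<in>Lambda T.
      t' < t \<and> d_inf T (t, \<omega>) (t', \<omega>') < \<delta> \<longrightarrow> \<bar>H t \<omega> - H t' \<omega>'\<bar> < \<epsilon>"
    by auto
  then show thesis by (intro that[of \<delta>]) auto
qed

text \<open>Along a path frozen at \<open>u\<close> the stopped paths at times \<open>x\<close> and
  \<open>y\<close> coincide, so \<open>d_inf\<close> reduces to the time difference. This supplies
  the left-continuity required by \<open>right_derivative_bound\<close>.\<close>

lemma C00l_left_continuous: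
  assumes "H \<in> C00l T" "\<omega> \<in> cadlag_paths T" "u \<in> {0..T}" "u < x" "x \<le> T"
  shows "((\<lambda>y. H y (stopped T u \<omega>)) \<longlongrightarrow> H x (stopped T u \<omega>)) (at_left x)"
proof (rule tendstoI)
  fix \<epsilon> :: real assume "\<epsilon> > 0"
  have st: "stopped T y (stopped T u \<omega>) = stopped T u \<omega>" if "u \<le> y" "y \<le> x" for y
    using that assms by (subst stopped_stopped) (auto simp: min_def)
  have inL: "(y, stopped T u \<omega>) \<in> Lambda T" if "u \<le> y" "y \<le> x" for y
    using stopped_in_Lambda[OF stopped_cadlag[OF assms(2,3)], of y] st[OF that] that assms by auto
  obtain \<delta> where "\<delta> > 0" and \<delta>: "\<And>t' \<omega>'. (t', \<omega>') \<in> Lambda T \<Longrightarrow> t' < x \<Longrightarrow>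
      d_inf T (x, stopped T u \<omega>) (t', \<omega>') < \<delta> \<Longrightarrow> \<bar>H x (stopped T u \<omega>) - H t' \<omega>'\<bar> < \<epsilon>"
    using C00l_left[OF assms(1) inL[of x] \<open>\<epsilon> > 0\<close>] \<open>u < x\<close> by auto
  have near: "\<bar>H x (stopped T u \<omega>) - H y (stopped T u \<omega>)\<bar> < \<epsilon>" if "u \<le> y" "x - \<delta> < y" "y < x" for y
  proof (rule \<delta>)
    have "d_inf T (x, stopped T x (stopped T u \<omega>)) (y, stopped T y (stopped T u \<omega>)) \<le> 0 + \<bar>x - y\<bar>"
      using that assms by (intro d_inf_stopped_le) (auto simp: stopped_apply min_def)
    then show "d_inf T (x, stopped T u \<omega>) (y, stopped T u \<omega>) < \<delta>"
      using that \<open>u < x\<close> by (simp add: st)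
  qed (use that inL in auto)
  show "\<forall>\<^sub>F y in at_left x. dist (H y (stopped T u \<omega>)) (H x (stopped T u \<omega>)) < \<epsilon>"
    using \<open>\<delta> > 0\<close> \<open>u < x\<close>
    by (intro eventually_at_leftI[of "max u (x - \<delta>)"])
      (auto simp: dist_real_def abs_minus_commute[of "H _ _" "H x _"] intro: near)
qed

text \<open>With the path frozen at \<open>u\<close>, time is the only variable left, and
  \<open>hderiv\<close> is the right derivative of this function of time.\<close>

lemma horizontal_increment:
  assumes H: "H \<in> C00l T" "horizontally_differentiable T H"
    and \<omega>: "\<omega> \<in> cadlag_paths T" and uv: "0 \<le> u" "u \<le> v" "v \<le> T"
    and bound: "\<And>x. u \<le> x \<Longrightarrow> x < v \<Longrightarrow> \<bar>hderiv T H x (stopped T u \<omega>)\<bar> \<le> K"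
  shows "\<bar>H v (stopped T u \<omega>) - H u (stopped T u \<omega>)\<bar> \<le> K * (v - u)"
proof -
  have "\<bar>H v (stopped T u \<omega>) - H u (stopped T u \<omega>) - 0 * (v - u)\<bar> \<le> K * (v - u)"
  proof (rule right_derivative_bound[OF \<open>u \<le> v\<close>])
    fix x assume "u < x" "x \<le> v"
    then show "((\<lambda>y. H y (stopped T u \<omega>)) \<longlongrightarrow> H x (stopped T u \<omega>)) (at_left x)"
      using assms by (intro C00l_left_continuous) auto
  next
    fix x assume x: "u \<le> x" "x < v"
    have st: "stopped T x (stopped T u \<omega>) = stopped T u \<omega>"
      using x uv by (subst stopped_stopped) (auto simp: min_def)
    obtain l where l: "(hquot T H x (stopped T u \<omega>) \<longlongrightarrow> l) (at_right 0)"
      using H(2) stopped_cadlag[OF \<omega>, of u] x uv unfolding horizontally_differentiable_def by force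
    then have "hderiv T H x (stopped T u \<omega>) = l"
      using x uv unfolding hderiv_def by (simp add: tendsto_Lim)
    then show "\<exists>l. \<bar>l - 0\<bar> \<le> K \<and> ((\<lambda>h. (H (x + h) (stopped T u \<omega>) - H x (stopped T u \<omega>)) / h)
        \<longlongrightarrow> l) (at_right 0)"
      using bound[OF x] l unfolding hquot_def st by auto
  qed
  then show ?thesis by simp
qed

lemma C00l_bumped_continuous:
  assumes "H \<in> C00l T" "\<omega> \<in> cadlag_paths T" "t \<in> {0..T}"
  shows "((\<lambda>h. H t (bumped T t h \<omega>)) \<longlongrightarrow> H t (bumped T t k \<omega>)) (at k within A)"
proof (rule tendstoI)
  fix \<epsilon> :: real assume "\<epsilon> > 0"
  obtain \<delta> where "\<delta> > 0" and \<delta>: "\<And>\<omega>'. \<omega>' \<in> cadlag_paths T \<Longrightarrow> sup_dist T (bumped T t k \<omega>) \<omega>' < \<delta> \<Longrightarrow>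
      \<bar>H t (stopped T t (bumped T t k \<omega>)) - H t (stopped T t \<omega>')\<bar> < \<epsilon>"
    using C00l_continuous[OF assms(1,3) bumped_cadlag[OF assms(2,3), of k] \<open>\<epsilon> > 0\<close>] by blast
  have "\<bar>H t (bumped T t h \<omega>) - H t (bumped T t k \<omega>)\<bar> < \<epsilon>" if "\<bar>h - k\<bar> < \<delta>" for h
  proof -
    have "sup_dist T (bumped T t k \<omega>) (bumped T t h \<omega>) \<le> \<bar>h - k\<bar>"
      unfolding sup_dist_def using assms(3) by (intro cSUP_least) (auto simp: bumped_apply)
    then show ?thesis
      using \<delta>[OF bumped_cadlag[OF assms(2,3)], of h] that assms(3)
      by (simp add: stopped_bumped abs_minus_commute)
  qed
  then show "\<forall>\<^sub>F h in at k within A. dist (H t (bumped T t h \<omega>)) (H t (bumped T t k \<omega>)) < \<epsilon>"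
    using \<open>\<delta> > 0\<close> unfolding eventually_at by (auto simp: dist_real_def)
qed

lemma vertical_increment_affine:
  assumes H: "H \<in> C00l T" "vertically_differentiable T H"
    and \<omega>: "\<omega> \<in> cadlag_paths T" and t: "t \<in> {0..T}" and "a \<le> b"
    and bound: "\<And>h. a \<le> h \<Longrightarrow> h \<le> b \<Longrightarrow> \<bar>vderiv T H t (bumped T t h \<omega>) - c\<bar> \<le> K"
  shows "\<bar>H t (bumped T t b \<omega>) - H t (bumped T t a \<omega>) - c * (b - a)\<bar> \<le> K * (b - a)"
proof (rule right_derivative_bound[OF \<open>a \<le> b\<close>])
  fix x assume x: "a \<le> x" "x < b"
  obtain l where l: "(vquot T H t (bumped T t x \<omega>) \<longlongrightarrow> l) (at_right 0)"
    using H(2) bumped_cadlag[OF \<omega> t] t unfolding vertically_differentiable_def by blast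
  then have "vderiv T H t (bumped T t x \<omega>) = l"
    unfolding vderiv_def by (simp add: tendsto_Lim)
  then show "\<exists>l. \<bar>l - c\<bar> \<le> K \<and>
      ((\<lambda>h. (H t (bumped T t (x + h) \<omega>) - H t (bumped T t x \<omega>)) / h) \<longlongrightarrow> l) (at_right 0)"
    using bound[of x] x l t unfolding vquot_def by (auto simp: bumped_bumped stopped_bumped)
qed (rule C00l_bumped_continuous[OF H(1) \<omega> t])

text \<open>The vertical derivative is a limit from the right, so a negative bump is handled as an
  upward move from \<open>k\<close> to \<open>0\<close>. This is why the bound is asked for on both
  sides of \<open>0\<close>.\<close>

lemma vertical_increment_linear:
  assumes H: "H \<in> C00l T" "vertically_differentiable T H"
    and \<omega>: "\<omega> \<in> cadlag_paths T" and t: "t \<in> {0..T}"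
    and bound: "\<And>h. \<bar>h\<bar> \<le> \<bar>k\<bar> \<Longrightarrow> \<bar>vderiv T H t (bumped T t h \<omega>) - c\<bar> \<le> K"
  shows "\<bar>H t (bumped T t k \<omega>) - H t (stopped T t \<omega>) - c * k\<bar> \<le> K * \<bar>k\<bar>"
proof (cases "0 \<le> k")
  case True
  then show ?thesis
    using vertical_increment_affine[OF H \<omega> t True, of c K] bound by (simp add: stopped_eq_bumped)
next
  case False
  then have "\<bar>H t (bumped T t 0 \<omega>) - H t (bumped T t k \<omega>) - c * (0 - k)\<bar> \<le> K * (0 - k)"
    using bound by (intro vertical_increment_affine[OF H \<omega> t]) auto
  then show ?thesis using False by (simp add: stopped_eq_bumped)
qed

lemma vertical_increment:
  assumes "H \<in> C00l T" "vertically_differentiable T H" "\<omega> \<in> cadlag_paths T" "t \<in> {0..T}"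
    and "\<And>h. \<bar>h\<bar> \<le> \<bar>k\<bar> \<Longrightarrow> \<bar>vderiv T H t (bumped T t h \<omega>)\<bar> \<le> K"
  shows "\<bar>H t (bumped T t k \<omega>) - H t (stopped T t \<omega>)\<bar> \<le> K * \<bar>k\<bar>"
  using vertical_increment_linear[OF assms(1-4), of k 0 K] assms(5) by simp

text \<open>A first-order Taylor expansion: the bound on the second vertical derivative controls how
  far the first one moves over the whole bump, and \<open>vertical_increment_linear\<close>
  integrates this. Using the worst value throughout gives the constant \<open>K\<close> in place of
  \<open>K / 2\<close>.\<close>

lemma vertical_increment_second_order:
  assumes F: "F \<in> C00l T" "vertically_differentiable T F"
    and G: "vderiv T F \<in> C00l T" "vertically_differentiable T (vderiv T F)"
    and \<omega>: "\<omega> \<in> cadlag_paths T" and t: "t \<in> {0..T}" and "0 \<le> K"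
    and bound: "\<And>h. \<bar>h\<bar> \<le> \<bar>k\<bar> \<Longrightarrow> \<bar>vderiv T (vderiv T F) t (bumped T t h \<omega>)\<bar> \<le> K"
  shows "\<bar>F t (bumped T t k \<omega>) - F t (stopped T t \<omega>) - vderiv T F t (stopped T t \<omega>) * k\<bar> \<le> K * k\<^sup>2"
proof -
  have "\<bar>vderiv T F t (bumped T t h \<omega>) - vderiv T F t (stopped T t \<omega>)\<bar> \<le> K * \<bar>k\<bar>"
    if "\<bar>h\<bar> \<le> \<bar>k\<bar>" for h
  proof -
    have "\<bar>vderiv T F t (bumped T t h \<omega>) - vderiv T F t (stopped T t \<omega>)\<bar> \<le> K * \<bar>h\<bar>"
      using that bound by (intro vertical_increment[OF G \<omega> t]) auto
    also have "\<dots> \<le> K * \<bar>k\<bar>" using that \<open>0 \<le> K\<close> by (intro mult_left_mono)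
    finally show ?thesis .
  qed
  then have "\<bar>F t (bumped T t k \<omega>) - F t (stopped T t \<omega>) - vderiv T F t (stopped T t \<omega>) * k\<bar>
      \<le> K * \<bar>k\<bar> * \<bar>k\<bar>"
    by (rule vertical_increment_linear[OF F \<omega> t])
  then show ?thesis by (simp add: power2_eq_square mult.assoc)
qed

section \<open>Uniform bounds near a continuous path\<close>

text \<open>A uniform neighbourhood of \<open>S\<close>, imposed only up to time \<open>t\<close>
  because \<open>H t\<close> sees only the path stopped there. It is meant to contain the
  approximating staircases together with their small bumps.\<close>

definition tube :: "real \<Rightarrow> (real \<Rightarrow> real) \<Rightarrow> real \<Rightarrow> real \<Rightarrow> (real \<Rightarrow> real) set" where
  "tube T S \<delta> t = {\<omega> \<in> cadlag_paths T. \<forall>r\<in>{0..t}. \<bar>\<omega> r - S r\<bar> \<le> \<delta>}"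

lemma tubeI:
  "\<omega> \<in> cadlag_paths T \<Longrightarrow> (\<And>r. 0 \<le> r \<Longrightarrow> r \<le> t \<Longrightarrow> \<bar>\<omega> r - S r\<bar> \<le> \<delta>) \<Longrightarrow> \<omega> \<in> tube T S \<delta> t"
  by (simp add: tube_def)

text \<open>Boundedness preservation says nothing up to time \<open>T\<close>; there the bound comes from
  left-continuity of \<open>H\<close> at \<open>(T, S)\<close>, and at \<open>T\<close> itself from continuity at fixed time.\<close>

lemma bounded_on_tube:
  assumes "T > 0" and H: "H \<in> C00l T" "H \<in> boundedness_preserving T"
    and S: "S \<in> cadlag_paths T" "continuous_on {0..T} S"
  obtains \<delta> C where "\<delta> > 0" "C \<ge> 0"
    "\<And>t \<omega>. t \<in> {0..T} \<Longrightarrow> \<omega> \<in> tube T S \<delta> t \<Longrightarrow> \<bar>H t (stopped T t \<omega>)\<bar> \<le> C"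
proof -
  have "T \<in> {0..T}" using \<open>T > 0\<close> by simp
  obtain \<delta>1 where "\<delta>1 > 0" and \<delta>1: "\<And>t' \<omega>'. (t', \<omega>') \<in> Lambda T \<Longrightarrow> t' < T \<Longrightarrow>
      d_inf T (T, stopped T T S) (t', \<omega>') < \<delta>1 \<Longrightarrow> \<bar>H T (stopped T T S) - H t' \<omega>'\<bar> < 1"
    using C00l_left[OF H(1) stopped_in_Lambda[OF S(1) \<open>T \<in> _\<close>] zero_less_one] by blast
  obtain \<delta>2 where "\<delta>2 > 0" and \<delta>2: "\<And>\<omega>'. \<omega>' \<in> cadlag_paths T \<Longrightarrow> sup_dist T S \<omega>' < \<delta>2 \<Longrightarrow>
      \<bar>H T (stopped T T S) - H T (stopped T T \<omega>')\<bar> < 1"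
    using C00l_continuous[OF H(1) \<open>T \<in> _\<close> S(1) zero_less_one] by blast
  obtain \<eta> where "\<eta> > 0" and \<eta>: "\<And>r. r \<in> {0..T} \<Longrightarrow> \<bar>r - T\<bar> < \<eta> \<Longrightarrow> \<bar>S r - S T\<bar> < \<delta>1 / 4"
  proof -
    have "\<delta>1 / 4 > 0" using \<open>\<delta>1 > 0\<close> by simp
    then show ?thesis
      using that S(2)[unfolded continuous_on_iff dist_real_def, rule_format, OF \<open>T \<in> _\<close>] by blast
  qed
  \<comment> \<open>After \<open>t0\<close> the distance \<open>\<delta>1\<close> is spent in
    quarters: one for \<open>\<omega>\<close> against \<open>S\<close> at \<open>t\<close>, two for
    \<open>S\<close> between \<open>r\<close>, \<open>T\<close> and \<open>t\<close>, and one for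
    the time difference \<open>T - t\<close>.\<close>
  define t0 where "t0 = max 0 (T - min \<eta> (\<delta>1 / 4))"
  have t0: "t0 \<in> {0..<T}" using \<open>\<eta> > 0\<close> \<open>\<delta>1 > 0\<close> \<open>T > 0\<close> by (auto simp: t0_def)
  have "compact (S ` {0..T})" using S(2) by (intro compact_continuous_image) auto
  then obtain B where "B > 0" and B: "\<And>r. r \<in> {0..T} \<Longrightarrow> \<bar>S r\<bar> \<le> B"
    by (auto dest!: compact_imp_bounded simp: bounded_pos)
  obtain C0 where "C0 > 0" and C0: "\<And>t \<omega>. t \<in> {0..t0} \<Longrightarrow> \<omega> \<in> cadlag_paths T \<Longrightarrow>
      \<forall>s\<in>{0..t}. \<bar>\<omega> s\<bar> \<le> B + 1 \<Longrightarrow> \<bar>H t (stopped T t \<omega>)\<bar> \<le> C0"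
  proof -
    have "B + 1 > 0" using \<open>B > 0\<close> by simp
    then show ?thesis using that H(2) t0 unfolding boundedness_preserving_def by blast
  qed
  define \<delta> where "\<delta> = min 1 (min (\<delta>1 / 4) (\<delta>2 / 2))"
  have \<delta>: "\<delta> > 0" "\<delta> \<le> 1" "\<delta> \<le> \<delta>1 / 4" "\<delta> < \<delta>2"
    using \<open>\<delta>1 > 0\<close> \<open>\<delta>2 > 0\<close> by (auto simp: \<delta>_def)
  define C where "C = max C0 (\<bar>H T (stopped T T S)\<bar> + 1)"
  show thesis
  proof (rule that[of \<delta> C])
    fix t \<omega> assume t: "t \<in> {0..T}" and "\<omega> \<in> tube T S \<delta> t"
    then have \<omega>: "\<omega> \<in> cadlag_paths T" and close: "\<And>r. r \<in> {0..t} \<Longrightarrow> \<bar>\<omega> r - S r\<bar> \<le> \<delta>"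
      by (auto simp: tube_def)
    consider "t \<le> t0" | "t0 < t" "t < T" | "t = T" using t by fastforce
    then show "\<bar>H t (stopped T t \<omega>)\<bar> \<le> C"
    proof cases
      case 1
      have "\<bar>\<omega> s\<bar> \<le> B + 1" if "s \<in> {0..t}" for s
        using close[OF that] B[of s] \<delta>(2) that t by auto
      then have "\<bar>H t (stopped T t \<omega>)\<bar> \<le> C0" using 1 t by (intro C0 \<omega>) auto
      then show ?thesis by (simp add: C_def)
    next
      case 2
      have "\<bar>S (min r T) - \<omega> (min r t)\<bar> \<le> 3 * \<delta>1 / 4" if "r \<in> {0..T}" for r
      proof (cases "r \<le> t")
        case True
        have "\<bar>\<omega> r - S r\<bar> \<le> \<delta>" using close True that by simp
        then show ?thesis using True that \<delta>(3) \<open>\<delta>1 > 0\<close> by (simp add: abs_minus_commute)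
      next
        case False
        have "\<bar>r - T\<bar> < \<eta>" "\<bar>t - T\<bar> < \<eta>" using False 2 that by (auto simp: t0_def)
        then have "\<bar>S r - S T\<bar> < \<delta>1 / 4" "\<bar>S t - S T\<bar> < \<delta>1 / 4"
          using that t by (auto intro!: \<eta> simp del: less_divide_eq_numeral1)
        moreover have "\<bar>\<omega> t - S t\<bar> \<le> \<delta>1 / 4" using close[of t] t \<delta>(3) by auto
        ultimately have "\<bar>S r - \<omega> t\<bar> \<le> 3 * \<delta>1 / 4" by argo
        then show ?thesis using False that by simp
      qed
      then have "d_inf T (T, stopped T T S) (t, stopped T t \<omega>) \<le> 3 * \<delta>1 / 4 + \<bar>T - t\<bar>"
        by (intro d_inf_stopped_le \<open>T \<in> _\<close> t)
      then have "d_inf T (T, stopped T T S) (t, stopped T t \<omega>) < \<delta>1" using 2 by (auto simp: t0_def)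
      from \<delta>1[OF stopped_in_Lambda[OF \<omega> t] \<open>t < T\<close> this] show ?thesis by (simp add: C_def)
    next
      case 3
      have "sup_dist T S \<omega> \<le> \<delta>"
        unfolding sup_dist_def using close 3 \<open>T > 0\<close>
        by (intro cSUP_least) (auto simp: abs_minus_commute)
      then have "\<bar>H T (stopped T T S) - H T (stopped T T \<omega>)\<bar> < 1"
        using \<delta>(4) by (intro \<delta>2 \<omega>) simp
      then show ?thesis using 3 by (simp add: C_def)
    qed
  qed (use \<delta> \<open>C0 > 0\<close> in \<open>auto simp: C_def\<close>)
qed

section \<open>Expansion along staircases\<close>

text \<open>Follows \<open>S\<close> up to \<open>\<tau> 0\<close> and is then a step function
  taking the value \<open>S (\<tau> j)\<close> from \<open>\<tau> j\<close> on. Each new step is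
  written as a bump, so that passing to the next staircase is literally one vertical move after a
  stretch on which the path is frozen.\<close>

primrec staircase :: "real \<Rightarrow> (nat \<Rightarrow> real) \<Rightarrow> (real \<Rightarrow> real) \<Rightarrow> nat \<Rightarrow> real \<Rightarrow> real" where
  "staircase T \<tau> S 0 = stopped T (\<tau> 0) S"
| "staircase T \<tau> S (Suc i) =
     bumped T (\<tau> (Suc i)) (S (\<tau> (Suc i)) - S (\<tau> i)) (staircase T \<tau> S i)"

lemma staircase_cadlag:
  assumes "S \<in> cadlag_paths T" and "\<And>j. j \<le> i \<Longrightarrow> \<tau> j \<in> {0..T}"
  shows "staircase T \<tau> S i \<in> cadlag_paths T"
  using assms(2) by (induction i) (auto intro!: stopped_cadlag bumped_cadlag assms(1))

lemma staircase_after: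
  assumes "\<And>j. j \<le> i \<Longrightarrow> \<tau> j \<in> {0..T}" and "\<And>j. j < i \<Longrightarrow> \<tau> j \<le> \<tau> (Suc j)"
    and "\<tau> i \<le> r" "r \<le> T"
  shows "staircase T \<tau> S i r = S (\<tau> i)"
  using assms
proof (induction i arbitrary: r)
  case 0
  then show ?case by (simp add: stopped_apply min_absorb2)
next
  case (Suc i)
  have "staircase T \<tau> S i (\<tau> (Suc i)) = S (\<tau> i)"
    using Suc.prems by (intro Suc.IH) auto
  moreover have "r \<in> {0..T}" using Suc.prems(1)[of "Suc i"] Suc.prems(3,4) by simp
  ultimately show ?case using Suc.prems(3) by (simp add: bumped_apply)
qed

lemma staircase_close:
  assumes "\<And>j. j \<le> i \<Longrightarrow> \<tau> j \<in> {0..T}" and "\<And>j. j < i \<Longrightarrow> \<tau> j \<le> \<tau> (Suc j)" and "0 \<le> e"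
    and osc: "\<And>j x y. j < i \<Longrightarrow> x \<in> {\<tau> j..\<tau> (Suc j)} \<Longrightarrow> y \<in> {\<tau> j..\<tau> (Suc j)} \<Longrightarrow> \<bar>S x - S y\<bar> \<le> e"
    and "0 \<le> r" "r \<le> \<tau> i"
  shows "\<bar>staircase T \<tau> S i r - S r\<bar> \<le> e"
  using assms
proof (induction i arbitrary: r)
  case 0
  then show ?case by (auto simp: stopped_apply min_def)
next
  case (Suc i)
  have r: "r \<in> {0..T}" using Suc.prems(1)[of "Suc i"] Suc.prems(5,6) by simp
  \<comment> \<open>Consecutive times may coincide, hence the separate condition
    \<open>r < \<tau> (Suc i)\<close>. At \<open>\<tau> (Suc i)\<close> the bump has already acted,
    and the staircase agrees with \<open>S\<close>.\<close>
  consider "r \<le> \<tau> i" "r < \<tau> (Suc i)" | "\<tau> i < r" "r < \<tau> (Suc i)" | "r = \<tau> (Suc i)"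
    using Suc.prems(6) by linarith
  then show ?case
  proof cases
    case 1
    have "\<bar>staircase T \<tau> S i r - S r\<bar> \<le> e"
    proof (rule Suc.IH)
      fix j x y assume "j < i" "x \<in> {\<tau> j..\<tau> (Suc j)}" "y \<in> {\<tau> j..\<tau> (Suc j)}"
      then show "\<bar>S x - S y\<bar> \<le> e" by (intro Suc.prems(4)[of j]) auto
    qed (use 1 Suc.prems in auto)
    then show ?thesis using 1 r by (simp add: bumped_apply)
  next
    case 2
    have "staircase T \<tau> S i r = S (\<tau> i)" using 2 r Suc.prems by (intro staircase_after) auto
    then show ?thesis using 2 r Suc.prems(4)[of i "\<tau> i" r] by (simp add: bumped_apply)
  next
    case 3
    have "staircase T \<tau> S (Suc i) r = S (\<tau> (Suc i))"
      using 3 r Suc.prems by (intro staircase_after) auto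
    then show ?thesis using 3 \<open>0 \<le> e\<close> by simp
  qed
qed

text \<open>The staircase is constant from \<open>\<tau> i\<close> on. Therefore \<open>F u\<close>
  and \<open>G u\<close> may be evaluated directly at it for every later \<open>u\<close>.\<close>

lemma stopped_staircase:
  assumes "S \<in> cadlag_paths T"
    and "\<And>j. j \<le> i \<Longrightarrow> \<tau> j \<in> {0..T}" and "\<And>j. j < i \<Longrightarrow> \<tau> j \<le> \<tau> (Suc j)"
    and "\<tau> i \<le> u" "u \<le> T"
  shows "stopped T u (staircase T \<tau> S i) = staircase T \<tau> S i"
proof
  fix r
  have "staircase T \<tau> S i \<in> extensional {0..T}"
    using staircase_cadlag[of S T i \<tau>, OF assms(1,2)] by (simp add: cadlag_paths_def)
  moreover have "staircase T \<tau> S i u = staircase T \<tau> S i r" if "u \<le> r" "r \<le> T"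
    using staircase_after[of i \<tau> T u S, OF assms(2,3)] staircase_after[of i \<tau> T r S, OF assms(2,3)]
      that assms(4,5) by simp
  ultimately show "stopped T u (staircase T \<tau> S i) r = staircase T \<tau> S i r"
    by (auto simp: stopped_def restrict_def extensional_def min_def)
qed

section \<open>First-order expansion along a path\<close>

text \<open>Boundedness is assumed here in the form produced by \<open>bounded_on_tube\<close>: one
  constant \<open>K\<close> for both derivatives of \<open>G\<close>, valid on the
  \<open>\<delta>\<close>-tube up to and including time \<open>T\<close>.\<close>

locale lipschitz_functional =
  fixes T :: real and S :: "real \<Rightarrow> real" and F G :: functional and L K \<delta> :: real
  assumes T: "T > 0"
    and S_cadlag: "S \<in> cadlag_paths T" and S_cont: "continuous_on {0..T} S"
    and F: "F \<in> C00l T" "vertically_differentiable T F"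
    and G_eq: "G = vderiv T F"
    and G: "G \<in> C00l T" "vertically_differentiable T G" "horizontally_differentiable T G"
    and L: "L \<ge> 0"
    and lipschitz: "\<And>t \<omega> t' \<omega>'. (t, \<omega>) \<in> Lambda T \<Longrightarrow> (t', \<omega>') \<in> Lambda T \<Longrightarrow>
      \<bar>F t \<omega> - F t' \<omega>'\<bar> \<le> L * d_inf T (t, \<omega>) (t', \<omega>')"
    and K: "K \<ge> 0" and \<delta>: "\<delta> > 0"
    and vderiv_bound: "\<And>t \<omega>. t \<in> {0..T} \<Longrightarrow> \<omega> \<in> tube T S \<delta> t \<Longrightarrow>
      \<bar>vderiv T G t (stopped T t \<omega>)\<bar> \<le> K"
    and hderiv_bound: "\<And>t \<omega>. t \<in> {0..T} \<Longrightarrow> \<omega> \<in> tube T S \<delta> t \<Longrightarrow>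
      \<bar>hderiv T G t (stopped T t \<omega>)\<bar> \<le> K"
begin

abbreviation f :: "real \<Rightarrow> real" where "f t \<equiv> F t (stopped T t S)"
abbreviation g :: "real \<Rightarrow> real" where "g t \<equiv> G t (stopped T t S)"

lemma lipschitz_stopped:
  assumes "t \<in> {0..T}" "t' \<in> {0..T}" "\<omega> \<in> cadlag_paths T" "\<omega>' \<in> cadlag_paths T"
    and "\<And>r. r \<in> {0..T} \<Longrightarrow> \<bar>\<omega> (min r t) - \<omega>' (min r t')\<bar> \<le> D"
  shows "\<bar>F t (stopped T t \<omega>) - F t' (stopped T t' \<omega>')\<bar> \<le> L * (D + \<bar>t - t'\<bar>)"
proof -
  have "\<bar>F t (stopped T t \<omega>) - F t' (stopped T t' \<omega>')\<bar>
      \<le> L * d_inf T (t, stopped T t \<omega>) (t', stopped T t' \<omega>')"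
    using assms by (intro lipschitz stopped_in_Lambda)
  also have "\<dots> \<le> L * (D + \<bar>t - t'\<bar>)"
    using assms L by (intro mult_left_mono d_inf_stopped_le) auto
  finally show ?thesis .
qed

lemma f_increment:
  assumes "s \<in> {0..T}" "t \<in> {0..T}" "s \<le> t"
    and osc: "\<And>x y. x \<in> {s..t} \<Longrightarrow> y \<in> {s..t} \<Longrightarrow> \<bar>S x - S y\<bar> \<le> D"
  shows "\<bar>f t - f s\<bar> \<le> L * (D + (t - s))"
proof -
  have "0 \<le> D" using osc[of s s] assms(3) by simp
  then have "\<bar>S (min r t) - S (min r s)\<bar> \<le> D" if "r \<in> {0..T}" for r
    using that assms(3) by (auto simp: min_def intro!: osc)
  then show ?thesis using lipschitz_stopped[OF assms(2,1) S_cadlag S_cadlag, of D] assms(3) by simp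
qed

lemma bumped_in_tube:
  assumes "\<omega> \<in> cadlag_paths T" "t \<in> {0..T}" and "\<bar>h\<bar> \<le> k" "D + k \<le> \<delta>"
    and "\<And>r. 0 \<le> r \<Longrightarrow> r \<le> t \<Longrightarrow> \<bar>\<omega> r - S r\<bar> \<le> D"
  shows "bumped T t h \<omega> \<in> tube T S \<delta> t"
proof (rule tubeI)
  fix r assume r: "0 \<le> r" "r \<le> t"
  show "\<bar>bumped T t h \<omega> r - S r\<bar> \<le> \<delta>"
    using assms(5)[OF r] r assms(2-4) by (auto simp: bumped_apply)
qed (use assms bumped_cadlag in auto)

text \<open>The compared quantity is the value of \<open>F\<close> predicted from step
  \<open>i\<close> when the path is to end at height \<open>z\<close>. A jump
  \<open>\<Delta>\<close> raises \<open>F\<close> by about \<open>G * \<Delta>\<close> and lowers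
  the distance still to go by \<open>\<Delta>\<close>, so the first-order effects cancel. What
  remains is the second-order error of the jump, the passage of time, and the change of
  \<open>G\<close> times the remaining distance.\<close>

lemma staircase_step:
  assumes i: "i < N"
    and \<tau>: "\<And>j. j \<le> N \<Longrightarrow> \<tau> j \<in> {0..T}" "\<And>j. j < N \<Longrightarrow> \<tau> j \<le> \<tau> (Suc j)"
      "\<And>j. j < N \<Longrightarrow> \<tau> (Suc j) - \<tau> j \<le> d"
    and osc: "\<And>j x y. j < N \<Longrightarrow> x \<in> {\<tau> j..\<tau> (Suc j)} \<Longrightarrow> y \<in> {\<tau> j..\<tau> (Suc j)} \<Longrightarrow> \<bar>S x - S y\<bar> \<le> e"
    and e: "0 \<le> e" "2 * e \<le> \<delta>"
    and D: "\<bar>z - S (\<tau> (Suc i))\<bar> \<le> D"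
  defines "X \<equiv> staircase T \<tau> S"
  shows "\<bar>(F (\<tau> (Suc i)) (X (Suc i)) + G (\<tau> (Suc i)) (X (Suc i)) * (z - S (\<tau> (Suc i)))) -
      (F (\<tau> i) (X i) + G (\<tau> i) (X i) * (z - S (\<tau> i)))\<bar>
    \<le> K * e\<^sup>2 + L * d + K * d * e + K * (d + e) * D"
proof -
  define t u \<Delta> Y where defs: "t = \<tau> i" "u = \<tau> (Suc i)" "\<Delta> = S u - S t" "Y = X i"
  have t: "t \<in> {0..T}" and u: "u \<in> {0..T}" and tu: "t \<le> u" "u - t \<le> d"
    using \<tau> i by (auto simp: defs)
  have \<Delta>: "\<bar>\<Delta>\<bar> \<le> e" using osc[OF i, of u t] tu by (simp add: defs)
  have Y: "Y \<in> cadlag_paths T"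
    unfolding defs X_def using \<tau> i by (intro staircase_cadlag S_cadlag) auto
  have stopY: "stopped T x Y = Y" if "t \<le> x" "x \<le> T" for x
    unfolding defs X_def using \<tau> i that
    by (intro stopped_staircase S_cadlag) (auto simp: defs)
  have Yafter: "Y x = S t" if "t \<le> x" "x \<le> T" for x
    unfolding defs X_def using \<tau> i that
    by (intro staircase_after) (auto simp: defs)
  have Yclose: "\<bar>Y r - S r\<bar> \<le> e" if "0 \<le> r" "r \<le> u" for r
  proof (cases "r \<le> t")
    case True
    show ?thesis
      unfolding defs X_def
    proof (rule staircase_close)
      fix j x y assume "j < i" "x \<in> {\<tau> j..\<tau> (Suc j)}" "y \<in> {\<tau> j..\<tau> (Suc j)}"
      then show "\<bar>S x - S y\<bar> \<le> e" using i by (intro osc[of j]) auto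
    qed (use True \<tau> i that e in \<open>auto simp: defs\<close>)
  next
    case False
    then show ?thesis using Yafter[of r] that u osc[OF i, of t r] by (simp add: defs)
  qed
  have Xi: "X (Suc i) = bumped T u \<Delta> Y" by (simp add: defs X_def)
  \<comment> \<open>The path \<open>Y\<close> is within \<open>e\<close> of \<open>S\<close> up to
    \<open>u\<close>, and the bump adds at most \<open>e\<close>; this is the origin of the
    condition \<open>2 * e \<le> \<delta>\<close>.\<close>
  have bound: "\<bar>vderiv T G u (bumped T u h Y)\<bar> \<le> K" if "\<bar>h\<bar> \<le> \<bar>\<Delta>\<bar>" for h
    using vderiv_bound[OF u bumped_in_tube[OF Y u, of h e e]] Yclose that \<Delta> e u
    by (simp add: stopped_bumped)
  have a: "\<bar>F u (bumped T u \<Delta> Y) - F u Y - G u Y * \<Delta>\<bar> \<le> K * e\<^sup>2"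
  proof -
    have "\<bar>F u (bumped T u \<Delta> Y) - F u (stopped T u Y) - vderiv T F u (stopped T u Y) * \<Delta>\<bar> \<le> K * \<Delta>\<^sup>2"
      using F G bound K by (intro vertical_increment_second_order Y u) (auto simp: G_eq)
    also have "\<Delta>\<^sup>2 \<le> e\<^sup>2" using \<Delta> e(1) by (simp add: abs_le_square_iff[symmetric])
    finally show ?thesis using K stopY[of u] tu u by (simp add: G_eq mult_left_mono)
  qed
  \<comment> \<open>\<open>Y\<close> is constant from \<open>t\<close> on, so the two stopped paths
    are equal and the Lipschitz bound is charged for elapsed time alone.\<close>
  have b: "\<bar>F u Y - F t Y\<bar> \<le> L * d"
  proof -
    have "\<bar>F u (stopped T u Y) - F t (stopped T t Y)\<bar> \<le> L * (0 + \<bar>u - t\<bar>)"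
      using tu t u Yafter by (intro lipschitz_stopped Y) (auto simp: min_def)
    also have "\<dots> \<le> L * d" using tu L by (intro mult_left_mono) auto
    finally show ?thesis using stopY[of u] stopY[of t] tu t u by simp
  qed
  have c: "\<bar>G u Y - G t Y\<bar> \<le> K * d"
  proof -
    have "\<bar>G u (stopped T t Y) - G t (stopped T t Y)\<bar> \<le> K * (u - t)"
    proof (rule horizontal_increment[OF G(1,3) Y])
      fix x assume x: "t \<le> x" "x < u"
      have "Y \<in> tube T S \<delta> x"
      proof (rule tubeI[OF Y])
        fix r assume "0 \<le> r" "r \<le> x"
        then show "\<bar>Y r - S r\<bar> \<le> \<delta>" using Yclose[of r] x e by simp
      qed
      from hderiv_bound[OF _ this] show "\<bar>hderiv T G x (stopped T t Y)\<bar> \<le> K"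
        using x t u stopY by simp
    qed (use t u tu in auto)
    also have "\<dots> \<le> K * d" using tu K by (intro mult_left_mono) auto
    finally show ?thesis using stopY[of t] t by simp
  qed
  have d: "\<bar>G u (bumped T u \<Delta> Y) - G u Y\<bar> \<le> K * e"
  proof -
    have "\<bar>G u (bumped T u \<Delta> Y) - G u (stopped T u Y)\<bar> \<le> K * \<bar>\<Delta>\<bar>"
      using bound by (intro vertical_increment G Y u) auto
    also have "\<dots> \<le> K * e" using \<Delta> K by (intro mult_left_mono) auto
    finally show ?thesis using stopY[of u] tu u by simp
  qed
  have "\<bar>(G u Y - G t Y) * \<Delta>\<bar> \<le> K * d * e"
    unfolding abs_mult using c \<Delta> K tu by (intro mult_mono) auto
  moreover have "\<bar>(G u (bumped T u \<Delta> Y) - G t Y) * (z - S u)\<bar> \<le> K * (d + e) * D"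
    unfolding abs_mult
  proof (rule mult_mono)
    show "\<bar>G u (bumped T u \<Delta> Y) - G t Y\<bar> \<le> K * (d + e)"
      using c d unfolding distrib_left by argo
    show "\<bar>z - S u\<bar> \<le> D" using D by (simp add: defs)
  qed (use K e tu in auto)
  moreover have "(F u (bumped T u \<Delta> Y) + G u (bumped T u \<Delta> Y) * (z - S u)) -
      (F t Y + G t Y * (z - S t)) =
    (F u (bumped T u \<Delta> Y) - F u Y - G u Y * \<Delta>) + (F u Y - F t Y) + (G u Y - G t Y) * \<Delta> +
    (G u (bumped T u \<Delta> Y) - G t Y) * (z - S u)"
    by (simp add: defs(3) algebra_simps)
  ultimately have "\<bar>(F u (bumped T u \<Delta> Y) + G u (bumped T u \<Delta> Y) * (z - S u)) -
      (F t Y + G t Y * (z - S t))\<bar> \<le> K * e\<^sup>2 + L * d + K * d * e + K * (d + e) * D"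
    using a b by argo
  then show ?thesis unfolding Xi unfolding defs by simp
qed

lemma staircase_estimate:
  assumes \<tau>: "\<And>j. j \<le> N \<Longrightarrow> \<tau> j \<in> {0..T}" "\<And>j. j < N \<Longrightarrow> \<tau> j \<le> \<tau> (Suc j)"
      "\<And>j. j < N \<Longrightarrow> \<tau> (Suc j) - \<tau> j \<le> d"
    and osc: "\<And>j x y. j < N \<Longrightarrow> x \<in> {\<tau> j..\<tau> (Suc j)} \<Longrightarrow> y \<in> {\<tau> j..\<tau> (Suc j)} \<Longrightarrow> \<bar>S x - S y\<bar> \<le> e"
    and e: "0 \<le> e" "2 * e \<le> \<delta>"
    and D: "\<And>j. j \<le> N \<Longrightarrow> \<bar>S (\<tau> N) - S (\<tau> j)\<bar> \<le> D"
  shows "\<bar>f (\<tau> N) - f (\<tau> 0) - g (\<tau> 0) * (S (\<tau> N) - S (\<tau> 0))\<bar>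
    \<le> L * e + N * (K * e\<^sup>2 + L * d + K * d * e + K * (d + e) * D)"
proof -
  define X where "X = staircase T \<tau> S"
  \<comment> \<open>Telescoping \<open>Q\<close> amounts to summation by parts. Estimating the increments of \<open>F\<close> one by one
    against \<open>g (\<tau> 0)\<close> would lose a factor \<open>N\<close>.\<close>
  define Q where "Q i = F (\<tau> i) (X i) + G (\<tau> i) (X i) * (S (\<tau> N) - S (\<tau> i))" for i
  define R where "R = K * e\<^sup>2 + L * d + K * d * e + K * (d + e) * D"
  have "\<bar>Q i - Q 0\<bar> \<le> i * R" if "i \<le> N" for i
    using that
  proof (induction i)
    case (Suc i)
    have "\<bar>Q (Suc i) - Q i\<bar> \<le> R"
      unfolding Q_def R_def X_def using Suc.prems
      by (intro staircase_step[of i N \<tau> d e "S (\<tau> N)" D, OF _ \<tau> osc e] D) auto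
    then show ?case using Suc by (simp add: distrib_right)
  qed simp
  \<comment> \<open>The linear term of \<open>Q N\<close> vanishes, and \<open>Q 0\<close> is formed
    with \<open>S\<close> stopped at \<open>\<tau> 0\<close>, hence with \<open>f (\<tau> 0)\<close>
    and \<open>g (\<tau> 0)\<close>. Only the replacement of the last staircase by \<open>S\<close>
    is left, outside the factor \<open>N\<close>.\<close>
  from this[of N] have "\<bar>F (\<tau> N) (X N) - f (\<tau> 0) - g (\<tau> 0) * (S (\<tau> N) - S (\<tau> 0))\<bar> \<le> N * R"
    by (simp add: Q_def X_def algebra_simps)
  moreover have "\<bar>f (\<tau> N) - F (\<tau> N) (X N)\<bar> \<le> L * e"
  proof -
    have "\<bar>X N r - S r\<bar> \<le> e" if "0 \<le> r" "r \<le> \<tau> N" for r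
      unfolding X_def by (rule staircase_close[of N \<tau> T e S, OF \<tau>(1,2) e(1) osc that])
    then have "\<bar>f (\<tau> N) - F (\<tau> N) (stopped T (\<tau> N) (X N))\<bar> \<le> L * (e + \<bar>\<tau> N - \<tau> N\<bar>)"
      unfolding X_def using \<tau>
      by (intro lipschitz_stopped S_cadlag staircase_cadlag) (auto simp: abs_minus_commute min_def)
    moreover have "stopped T (\<tau> N) (X N) = X N"
      unfolding X_def using \<tau> by (intro stopped_staircase S_cadlag) auto
    ultimately show ?thesis by simp
  qed
  ultimately show ?thesis unfolding R_def by argo
qed

text \<open>The vertical derivative is recovered from \<open>F\<close> by a difference quotient of step \<open>k\<close> up to
  an error of order \<open>k\<close>, which transfers the Lipschitz continuity of \<open>F\<close> to \<open>G\<close>.\<close>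

lemma g_increment:
  assumes "s \<in> {0..T}" "t \<in> {0..T}" "s \<le> t"
    and osc: "\<And>x y. x \<in> {s..t} \<Longrightarrow> y \<in> {s..t} \<Longrightarrow> \<bar>S x - S y\<bar> \<le> \<eta>"
    and k: "k > 0" "\<eta> + k \<le> \<delta>"
  shows "\<bar>g t - g s\<bar> \<le> K * (t - s) + 2 * K * k + 2 * L * \<eta> / k"
proof -
  \<comment> \<open>Freezing \<open>S\<close> at \<open>s\<close> splits the increment: from
    \<open>g t\<close> to \<open>G t U\<close> only the path changes, and from \<open>G t U\<close>
    to \<open>g s\<close> only the time.\<close>
  define U where "U = stopped T s S"
  have U: "U \<in> cadlag_paths T" unfolding U_def using assms by (intro stopped_cadlag S_cadlag)
  have "0 \<le> \<eta>" using osc[of s s] assms(3) by simp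
  have Uclose: "\<bar>U r - S r\<bar> \<le> \<eta>" if "0 \<le> r" "r \<le> t" for r
    using that assms(2,3) \<open>0 \<le> \<eta>\<close> by (auto simp: U_def stopped_apply min_def intro!: osc)
  have stopU: "stopped T x U = U" if "s \<le> x" "x \<le> T" for x
    unfolding U_def using assms that by (subst stopped_stopped) (auto simp: min_def)
  have second: "\<bar>F t (bumped T t k \<omega>) - F t (stopped T t \<omega>) - G t (stopped T t \<omega>) * k\<bar> \<le> K * k\<^sup>2"
    if \<omega>: "\<omega> \<in> cadlag_paths T" and close: "\<And>r. 0 \<le> r \<Longrightarrow> r \<le> t \<Longrightarrow> \<bar>\<omega> r - S r\<bar> \<le> \<eta>" for \<omega>
    unfolding G_eq
  proof (rule vertical_increment_second_order[OF F G(1,2)[unfolded G_eq] \<omega> assms(2) K])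
    fix h assume "\<bar>h\<bar> \<le> \<bar>k\<bar>"
    then have "bumped T t h \<omega> \<in> tube T S \<delta> t"
      using close k by (intro bumped_in_tube[OF \<omega> assms(2), of _ k \<eta>]) auto
    from vderiv_bound[OF assms(2) this] show "\<bar>vderiv T (vderiv T F) t (bumped T t h \<omega>)\<bar> \<le> K"
      using assms(2) by (simp add: stopped_bumped G_eq)
  qed
  have 1: "\<bar>F t (bumped T t k S) - f t - g t * k\<bar> \<le> K * k\<^sup>2"
    using \<open>0 \<le> \<eta>\<close> by (intro second S_cadlag) auto
  have 2: "\<bar>F t (bumped T t k U) - F t U - G t U * k\<bar> \<le> K * k\<^sup>2"
    using second[OF U Uclose] stopU[of t] assms by simp
  have 3: "\<bar>f t - F t U\<bar> \<le> L * \<eta>"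
  proof -
    have "\<bar>f t - F t (stopped T t U)\<bar> \<le> L * (\<eta> + \<bar>t - t\<bar>)"
      using Uclose assms(2)
      by (intro lipschitz_stopped S_cadlag U assms(2)) (auto simp: abs_minus_commute min_def)
    then show ?thesis using stopU[of t] assms by simp
  qed
  \<comment> \<open>Both paths receive the same bump, which leaves their distance unchanged.\<close>
  have 4: "\<bar>F t (bumped T t k S) - F t (bumped T t k U)\<bar> \<le> L * \<eta>"
  proof -
    have "\<bar>bumped T t k S r - bumped T t k U r\<bar> \<le> \<eta>" if "r \<in> {0..T}" for r
      using Uclose[of r] Uclose[of t] that assms(2) by (auto simp: bumped_apply)
    then have "\<bar>F t (stopped T t (bumped T t k S)) - F t (stopped T t (bumped T t k U))\<bar>
        \<le> L * (\<eta> + \<bar>t - t\<bar>)"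
      using assms(2) by (intro lipschitz_stopped bumped_cadlag S_cadlag U assms(2)) auto
    then show ?thesis using assms(2) by (simp add: stopped_bumped)
  qed
  have "\<bar>g t * k - G t U * k\<bar> \<le> 2 * K * k\<^sup>2 + 2 * L * \<eta>" using 1 2 3 4 by (simp add: abs_le_iff)
  moreover have "\<bar>g t * k - G t U * k\<bar> = \<bar>g t - G t U\<bar> * k"
    using k by (metis abs_mult abs_of_pos left_diff_distrib)
  ultimately have "\<bar>g t - G t U\<bar> * k \<le> 2 * K * k\<^sup>2 + 2 * L * \<eta>" by simp
  then have "\<bar>g t - G t U\<bar> \<le> (2 * K * k\<^sup>2 + 2 * L * \<eta>) / k" using k by (simp add: pos_le_divide_eq)
  also have "\<dots> = 2 * K * k + 2 * L * \<eta> / k" using k by (simp add: field_simps power2_eq_square)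
  finally have "\<bar>g t - G t U\<bar> \<le> 2 * K * k + 2 * L * \<eta> / k" .
  moreover have "\<bar>G t U - g s\<bar> \<le> K * (t - s)"
    unfolding U_def
  proof (rule horizontal_increment[OF G(1,3) S_cadlag])
    fix x assume x: "s \<le> x" "x < t"
    have "U \<in> tube T S \<delta> x"
    proof (rule tubeI[OF U])
      fix r assume "0 \<le> r" "r \<le> x"
      then show "\<bar>U r - S r\<bar> \<le> \<delta>" using Uclose[of r] x k by simp
    qed
    from hderiv_bound[OF _ this] show "\<bar>hderiv T G x (stopped T s S)\<bar> \<le> K"
      using x assms stopU[of x] by (simp add: U_def)
  qed (use assms in auto)
  ultimately show ?thesis by argo
qed

section \<open>Continuity along the path and the size of the remainder\<close>

lemma uniform_modulus:
  assumes "\<eta> > 0"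
  obtains d where "d > 0" "\<And>x y. x \<in> {0..T} \<Longrightarrow> y \<in> {0..T} \<Longrightarrow> \<bar>x - y\<bar> < d \<Longrightarrow> \<bar>S x - S y\<bar> \<le> \<eta>"
proof -
  have "uniformly_continuous_on {0..T} S"
    by (rule compact_uniformly_continuous[OF S_cont]) simp
  then obtain d where "d > 0" "\<forall>x\<in>{0..T}. \<forall>x'\<in>{0..T}. dist x' x < d \<longrightarrow> dist (S x') (S x) < \<eta>"
    using assms unfolding uniformly_continuous_on_def by blast
  then show thesis by (intro that[of d]) (force simp: dist_real_def)+
qed

text \<open>Stated uniformly on \<open>{0..T}\<close> because it also has to control the oscillation
  of \<open>f\<close> over the intervals of a partition.\<close>

lemma f_modulus:
  assumes "\<epsilon> > 0"
  obtains d where "d > 0" "\<And>x y. x \<in> {0..T} \<Longrightarrow> y \<in> {0..T} \<Longrightarrow> \<bar>x - y\<bar> < d \<Longrightarrow> \<bar>f x - f y\<bar> \<le> \<epsilon>"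
proof -
  define \<eta> where "\<eta> = \<epsilon> / (2 * (L + 1))"
  have \<eta>: "\<eta> > 0" "2 * L * \<eta> \<le> \<epsilon>" using assms L by (auto simp: \<eta>_def field_simps)
  obtain d where d: "d > 0" "\<And>x y. x \<in> {0..T} \<Longrightarrow> y \<in> {0..T} \<Longrightarrow> \<bar>x - y\<bar> < d \<Longrightarrow> \<bar>S x - S y\<bar> \<le> \<eta>"
    using uniform_modulus[OF \<eta>(1)] by blast
  have *: "\<bar>f y - f x\<bar> \<le> \<epsilon>" if "x \<in> {0..T}" "y \<in> {0..T}" "x \<le> y" "y - x < min d \<eta>" for x y
  proof -
    have "\<bar>f y - f x\<bar> \<le> L * (\<eta> + (y - x))"
      using that d(2) by (intro f_increment) auto
    also have "\<dots> \<le> L * (\<eta> + \<eta>)" using that L by (intro mult_left_mono) auto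
    finally show ?thesis using \<eta>(2) by simp
  qed
  show thesis
  proof (rule that[of "min d \<eta>"])
    fix x y assume "x \<in> {0..T}" "y \<in> {0..T}" "\<bar>x - y\<bar> < min d \<eta>"
    then show "\<bar>f x - f y\<bar> \<le> \<epsilon>"
      using *[of x y] *[of y x] by (cases "x \<le> y") (auto simp: abs_minus_commute)
  qed (use d \<eta> in auto)
qed

lemma f_continuous: "continuous_on {0..T} f"
  unfolding continuous_on_iff dist_real_def
proof (intro ballI allI impI)
  fix x and \<epsilon> :: real assume x: "x \<in> {0..T}" and "\<epsilon> > 0"
  then obtain d where "d > 0"
    "\<And>x y. x \<in> {0..T} \<Longrightarrow> y \<in> {0..T} \<Longrightarrow> \<bar>x - y\<bar> < d \<Longrightarrow> \<bar>f x - f y\<bar> \<le> \<epsilon> / 2"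
    using f_modulus[of "\<epsilon> / 2"] by auto
  then show "\<exists>d>0. \<forall>x'\<in>{0..T}. \<bar>x' - x\<bar> < d \<longrightarrow> \<bar>f x' - f x\<bar> < \<epsilon>"
    using x \<open>\<epsilon> > 0\<close> by (intro exI[of _ d]) fastforce
qed

lemma g_continuous: "continuous_on {0..T} g"
  unfolding continuous_on_iff dist_real_def
proof (intro ballI allI impI)
  fix x and \<epsilon> :: real assume x: "x \<in> {0..T}" and "\<epsilon> > 0"
  \<comment> \<open>The three terms of \<open>g_increment\<close> get \<open>\<epsilon> / 4\<close>
    each. The step \<open>k\<close> is fixed before \<open>\<eta>\<close> because
    \<open>\<eta>\<close> is divided by it. The halves of \<open>\<delta>\<close> give
    \<open>\<eta> + k \<le> \<delta>\<close>, and each \<open>+ 1\<close> guards against a vanishing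
    constant.\<close>
  define k where "k = min (\<delta> / 2) (\<epsilon> / (8 * (K + 1)))"
  have k: "k > 0" "k \<le> \<delta> / 2" "2 * K * k \<le> \<epsilon> / 4"
  proof -
    show "k \<le> \<delta> / 2" unfolding k_def by (rule min.cobounded1)
    show "k > 0" using \<delta> \<open>\<epsilon> > 0\<close> K by (simp add: k_def)
    have "k \<le> \<epsilon> / (8 * (K + 1))" by (simp add: k_def)
    then have "8 * (K + 1) * k \<le> \<epsilon>" using K by (simp add: field_simps)
    then show "2 * K * k \<le> \<epsilon> / 4" using \<open>k > 0\<close> by (simp add: algebra_simps)
  qed
  define \<eta> where "\<eta> = min (\<delta> / 2) (\<epsilon> * k / (8 * (L + 1)))"
  have \<eta>: "\<eta> > 0" "\<eta> \<le> \<delta> / 2" "2 * L * \<eta> / k \<le> \<epsilon> / 4"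
  proof -
    show "\<eta> \<le> \<delta> / 2" unfolding \<eta>_def by (rule min.cobounded1)
    show "\<eta> > 0" using \<delta> \<open>\<epsilon> > 0\<close> L k by (simp add: \<eta>_def)
    have "\<eta> \<le> \<epsilon> * k / (8 * (L + 1))" by (simp add: \<eta>_def)
    then have "8 * (L + 1) * \<eta> \<le> \<epsilon> * k" using L by (simp add: field_simps)
    then show "2 * L * \<eta> / k \<le> \<epsilon> / 4" using \<open>\<eta> > 0\<close> k by (simp add: field_simps)
  qed
  obtain d where d: "d > 0" "\<And>x y. x \<in> {0..T} \<Longrightarrow> y \<in> {0..T} \<Longrightarrow> \<bar>x - y\<bar> < d \<Longrightarrow> \<bar>S x - S y\<bar> \<le> \<eta>"
    using uniform_modulus[OF \<eta>(1)] by blast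
  define d' where "d' = min d (\<epsilon> / (4 * (K + 1)))"
  have *: "\<bar>g y - g x\<bar> < \<epsilon>" if "x \<in> {0..T}" "y \<in> {0..T}" "x \<le> y" "y - x < d'" for x y
  proof -
    have "\<bar>g y - g x\<bar> \<le> K * (y - x) + 2 * K * k + 2 * L * \<eta> / k"
      using that d(2) k \<eta> by (intro g_increment) (auto simp: d'_def)
    moreover have "K * (y - x) \<le> \<epsilon> / 4"
    proof -
      have "y - x \<le> \<epsilon> / (4 * (K + 1))" using that by (simp add: d'_def)
      then have "4 * (K + 1) * (y - x) \<le> \<epsilon>" using K by (simp add: field_simps)
      then show ?thesis using that by (simp add: algebra_simps)
    qed
    ultimately show ?thesis using k(3) \<eta>(3) \<open>\<epsilon> > 0\<close> by linarith
  qed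
  show "\<exists>d>0. \<forall>x'\<in>{0..T}. \<bar>x' - x\<bar> < d \<longrightarrow> \<bar>g x' - g x\<bar> < \<epsilon>"
  proof (intro exI[of _ d'] conjI ballI impI)
    show "d' > 0" using d \<open>\<epsilon> > 0\<close> K by (simp add: d'_def)
    fix y assume "y \<in> {0..T}" "\<bar>y - x\<bar> < d'"
    then show "\<bar>g y - g x\<bar> < \<epsilon>"
      using *[of x y] *[of y x] x by (cases "x \<le> y") (auto simp: abs_minus_commute)
  qed
qed

text \<open>For an interval of length \<open>h\<close>, the staircase estimate is used with about \<open>h powr -\<alpha>\<close>
  steps: this balances the approximation error \<open>(h / N) powr \<alpha>\<close> of the path against the
  accumulated error \<open>N * (h / N) powr \<alpha> * h powr \<alpha>\<close> from keeping \<open>G\<close> at its initial value.\<close>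

lemma remainder_bound:
  assumes \<alpha>: "0 < \<alpha>" "\<alpha> < 1" and \<beta>: "\<beta> \<le> 1" "\<beta> \<le> \<alpha> + \<alpha>\<^sup>2" and c: "c > 0"
    and holder: "\<And>x y. x \<in> {0..T} \<Longrightarrow> y \<in> {0..T} \<Longrightarrow> \<bar>S x - S y\<bar> \<le> c * \<bar>x - y\<bar> powr \<alpha>"
  obtains h0 C where "h0 > 0" "C \<ge> 0"
    "\<And>s t. s \<in> {0..T} \<Longrightarrow> t \<in> {0..T} \<Longrightarrow> s < t \<Longrightarrow> t - s \<le> h0 \<Longrightarrow>
      \<bar>f t - f s - g s * (S t - S s)\<bar> \<le> C * (t - s) powr \<beta>"
proof -
  \<comment> \<open>The second entry is the length at which \<open>c * h powr \<alpha>\<close>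
    reaches \<open>\<delta> / 2\<close>; below it the staircases and their bumps stay in the
    tube.\<close>
  define h0 where "h0 = min 1 ((\<delta> / (2 * c)) powr (1 / \<alpha>))"
  define C where "C = (L * c + 4 * K * c\<^sup>2) + (L + 2 * K * c)"
  have "h0 > 0" "h0 \<le> 1" using \<delta> c by (auto simp: h0_def)
  have "C \<ge> 0" using L K c by (simp add: C_def)
  show thesis
  proof (rule that[OF \<open>h0 > 0\<close> \<open>C \<ge> 0\<close>])
    fix s t assume st: "s \<in> {0..T}" "t \<in> {0..T}" "s < t" "t - s \<le> h0"
    define h where "h = t - s"
    have h: "0 < h" "h \<le> 1" "h \<le> h0" using st \<open>h0 \<le> 1\<close> by (auto simp: h_def)
    define N where "N = nat \<lceil>h powr - \<alpha>\<rceil>"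
    have N_ge: "h powr - \<alpha> \<le> real N" unfolding N_def by linarith
    have "0 < h powr - \<alpha>" using h by simp
    then have N_le: "real N \<le> h powr - \<alpha> + 1" unfolding N_def by linarith
    have N: "1 \<le> real N"
    proof -
      have "0 < real N" using N_ge \<open>0 < h powr - \<alpha>\<close> by linarith
      then show ?thesis by simp
    qed
    \<comment> \<open>Up to the factor \<open>c\<close>, \<open>x\<close> is the oscillation of
      \<open>S\<close> over one step of length \<open>d\<close> and \<open>y\<close> the one over
      the whole interval.\<close>
    define d x y where dxy: "d = h / N" "x = d powr \<alpha>" "y = h powr \<alpha>"
    have Nd: "N * d = h" using N by (simp add: dxy)
    have d: "0 < d" "d \<le> h" using N h by (auto simp: dxy divide_le_eq)
    have "d powr 1 \<le> d powr \<alpha>" using d h \<alpha> by (intro powr_mono') auto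
    then have "d \<le> x" using d by (simp add: dxy(2))
    have "0 < x" using d by (simp add: dxy(2))
    have "x \<le> y" unfolding dxy(2,3) using d \<alpha> by (intro powr_mono2) auto
    have "y \<le> 1" using h \<alpha> by (simp add: dxy powr_le1)
    have "h powr - \<alpha> * y = 1" using h by (simp add: dxy powr_minus)
    have Ny: "N * y \<le> 2"
    proof -
      have "N * y \<le> (h powr - \<alpha> + 1) * y" using N_le h by (intro mult_right_mono) (auto simp: dxy)
      then show ?thesis using \<open>h powr - \<alpha> * y = 1\<close> \<open>y \<le> 1\<close> by (simp add: distrib_right)
    qed
    have "x \<le> h powr (\<alpha> + \<alpha>\<^sup>2)"
    proof -
      have "h powr - \<alpha> * y \<le> N * y" by (intro mult_right_mono N_ge) (simp add: dxy(3))
      then have "1 \<le> N * y" using \<open>h powr - \<alpha> * y = 1\<close> by simp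
      then have "1 / N \<le> y" using N by (simp add: field_simps)
      then have "d \<le> h * y" using h mult_left_mono[of "1 / N" y h] by (simp add: dxy)
      also have "h * y = h powr (1 + \<alpha>)" using h by (simp add: dxy powr_add)
      finally have "x \<le> (h powr (1 + \<alpha>)) powr \<alpha>"
        unfolding dxy(2) using d \<alpha> by (intro powr_mono2) auto
      then show ?thesis by (simp add: powr_powr algebra_simps power2_eq_square)
    qed
    also have "\<dots> \<le> h powr \<beta>" using h \<beta> by (intro powr_mono') auto
    finally have "x \<le> h powr \<beta>" .
    have "h powr 1 \<le> h powr \<beta>" using h \<beta> by (intro powr_mono') auto
    then have "h \<le> h powr \<beta>" using h by simp
    have "c * y \<le> \<delta> / 2"
    proof -
      have "h \<le> (\<delta> / (2 * c)) powr (1 / \<alpha>)" using h by (simp add: h0_def)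
      then have "y \<le> ((\<delta> / (2 * c)) powr (1 / \<alpha>)) powr \<alpha>"
        unfolding dxy(3) using h \<alpha> by (intro powr_mono2) auto
      also have "\<dots> = \<delta> / (2 * c)" using \<delta> c \<alpha> by (simp add: powr_powr)
      finally show ?thesis using c by (simp add: field_simps)
    qed
    define \<tau> where "\<tau> j = s + real j * d" for j
    have \<tau>0: "\<tau> 0 = s" and \<tau>N: "\<tau> N = t" using Nd by (simp_all add: \<tau>_def h_def)
    have \<tau>_in: "\<tau> j \<in> {s..t}" if "j \<le> N" for j
    proof -
      have "real j * d \<le> real N * d" using that d by (intro mult_right_mono) auto
      then show ?thesis using d Nd by (simp add: \<tau>_def h_def)
    qed
    have \<tau>_Suc: "\<tau> (Suc j) - \<tau> j = d" for j by (simp add: \<tau>_def algebra_simps)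
    have osc: "\<bar>S a - S b\<bar> \<le> c * r powr \<alpha>"
      if "a \<in> {s..t}" "b \<in> {s..t}" "\<bar>a - b\<bar> \<le> r" for a b r
    proof -
      have "\<bar>S a - S b\<bar> \<le> c * \<bar>a - b\<bar> powr \<alpha>" using that st by (intro holder) auto
      also have "\<dots> \<le> c * r powr \<alpha>"
        using that c \<alpha> by (intro mult_left_mono powr_mono2) auto
      finally show ?thesis .
    qed
    have "\<bar>f (\<tau> N) - f (\<tau> 0) - g (\<tau> 0) * (S (\<tau> N) - S (\<tau> 0))\<bar>
      \<le> L * (c * x) + N * (K * (c * x)\<^sup>2 + L * d + K * d * (c * x) + K * (d + c * x) * (c * y))"
    proof (rule staircase_estimate)
      fix j assume "j \<le> N"
      from \<tau>_in[OF this] show "\<tau> j \<in> {0..T}" using st by auto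
      show "\<bar>S (\<tau> N) - S (\<tau> j)\<bar> \<le> c * y"
        unfolding dxy(3) using \<tau>_in[OF \<open>j \<le> N\<close>] \<tau>_in[of N] by (intro osc) (auto simp: h_def)
    next
      fix j a b assume *: "j < N" "a \<in> {\<tau> j..\<tau> (Suc j)}" "b \<in> {\<tau> j..\<tau> (Suc j)}"
      show "\<bar>S a - S b\<bar> \<le> c * x"
        unfolding dxy(2) using * \<tau>_in[of j] \<tau>_in[of "Suc j"] \<tau>_Suc[of j] by (intro osc) auto
    next
      have "c * x \<le> c * y" using c \<open>x \<le> y\<close> by simp
      then show "2 * (c * x) \<le> \<delta>" using \<open>c * y \<le> \<delta> / 2\<close> by simp
    next
      fix j
      show "\<tau> j \<le> \<tau> (Suc j)" "\<tau> (Suc j) - \<tau> j \<le> d" using \<tau>_Suc[of j] d by auto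
    qed (use c \<open>0 < x\<close> in simp)
    \<comment> \<open>Grouped so that \<open>N\<close> enters only through \<open>N * d = h\<close>
      and through \<open>N * x\<close> and \<open>N * y\<close>, both at most
      \<open>2\<close>.\<close>
    also have "\<dots> = L * c * x + K * c\<^sup>2 * (N * x * x) + L * (N * d) + K * c * (x * (N * d))
        + K * c * ((N * d) * y) + K * c\<^sup>2 * (N * y * x)"
      by (simp add: algebra_simps power2_eq_square)
    also have "\<dots> \<le> L * c * x + K * c\<^sup>2 * (2 * x) + L * h + K * c * h + K * c * h + K * c\<^sup>2 * (2 * x)"
    proof -
      have "N * x \<le> N * y" using \<open>x \<le> y\<close> by (intro mult_left_mono) auto
      then have "N * x * x \<le> 2 * x" using Ny \<open>0 < x\<close> by (intro mult_right_mono) auto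
      moreover have "N * y * x \<le> 2 * x" using Ny \<open>0 < x\<close> by (intro mult_right_mono) auto
      moreover have "x * h \<le> h" "h * y \<le> h"
        using \<open>x \<le> y\<close> \<open>y \<le> 1\<close> \<open>0 < x\<close> h by (auto intro: mult_left_le mult_left_le_one_le)
      ultimately show ?thesis
        unfolding Nd using K L c by (intro add_mono mult_left_mono) auto
    qed
    also have "\<dots> = (L * c + 4 * K * c\<^sup>2) * x + (L + 2 * K * c) * h" by (simp add: algebra_simps)
    also have "\<dots> \<le> (L * c + 4 * K * c\<^sup>2) * h powr \<beta> + (L + 2 * K * c) * h powr \<beta>"
      using \<open>x \<le> h powr \<beta>\<close> \<open>h \<le> h powr \<beta>\<close> K L c by (intro add_mono mult_left_mono) auto
    also have "\<dots> = C * h powr \<beta>" by (simp add: C_def algebra_simps)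
    finally show "\<bar>f t - f s - g s * (S t - S s)\<bar> \<le> C * (t - s) powr \<beta>"
      by (simp add: \<tau>0 \<tau>N h_def)
  qed
qed

end

section \<open>Increment measures\<close>

lemma ivalsD:
  assumes "partition_of T P" "(u, v) \<in> ivals P"
  shows "u \<in> {0..T}" "v \<in> {0..T}" "u < v"
  using assms by (auto simp: partition_of_def ivals_def)

lemma finite_ivals: "partition_of T P \<Longrightarrow> finite (ivals P)"
  by (rule finite_subset[of _ "P \<times> P"]) (auto simp: partition_of_def ivals_def)

text \<open>Needed because \<open>osc\<close> is a maximum, which has no specified value over an
  empty set.\<close>

lemma ivals_nonempty:
  assumes "partition_of T P" "T > 0"
  shows "ivals P \<noteq> {}"
proof -
  define v where "v = Min (P \<inter> {0<..})"
  have fin: "finite (P \<inter> {0<..})" and ne: "P \<inter> {0<..} \<noteq> {}"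
    using assms by (auto simp: partition_of_def)
  have "v \<in> P \<inter> {0<..}" unfolding v_def by (rule Min_in[OF fin ne])
  moreover have "P \<inter> {0<..<v} = {}"
    using Min_le[OF fin] unfolding v_def by force
  ultimately have "(0, v) \<in> ivals P" using assms by (auto simp: ivals_def partition_of_def)
  then show ?thesis by auto
qed

lemma ival_le_mesh:
  assumes "partition_of T P" "(u, v) \<in> ivals P"
  shows "v - u \<le> mesh P"
  unfolding mesh_def using assms finite_ivals[OF assms(1)]
  by (intro Max_ge) (auto intro!: image_eqI[of _ _ "(u, v)"])

text \<open>Reading the lengths as Lebesgue measures of disjoint open intervals inside
  \<open>{0..T}\<close> avoids listing the partition in increasing order.\<close>

lemma sum_ivals_le:
  assumes "partition_of T P"
  shows "(\<Sum>(u, v)\<in>ivals P. v - u) \<le> T"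
proof -
  define J :: "real \<times> real \<Rightarrow> real set" where "J i = {fst i<..<snd i}" for i
  have le: "fst i \<le> snd i" if "i \<in> ivals P" for i
    using ivalsD(3)[OF assms, of "fst i" "snd i"] that by simp
  have disj: "disjoint_family_on J (ivals P)"
    unfolding disjoint_family_on_def
  proof (intro ballI impI, rule ccontr)
    fix i j assume *: "i \<in> ivals P" "j \<in> ivals P" "i \<noteq> j" and "J i \<inter> J j \<noteq> {}"
    then obtain x where "x \<in> J i \<inter> J j" by blast
    then have x: "fst i < x" "x < snd i" "fst j < x" "x < snd j" by (auto simp: J_def)
    \<comment> \<open>No partition point lies inside a partition interval, so two overlapping
      intervals must share both endpoints.\<close>
    have "fst j \<notin> J i" "snd j \<notin> J i" "fst i \<notin> J j" "snd i \<notin> J j"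
      using * by (auto simp: ivals_def J_def)
    then have "fst i = fst j" "snd i = snd j" using x by (auto simp: J_def)
    then show False using \<open>i \<noteq> j\<close> by (simp add: prod_eq_iff)
  qed
  have "(\<Sum>(u, v)\<in>ivals P. v - u) = (\<Sum>i\<in>ivals P. measure lborel (J i))"
    unfolding split_def
    by (intro sum.cong refl) (simp only: J_def measure_lborel_Ioo[OF le])
  also have "\<dots> = measure lborel (\<Union>i\<in>ivals P. J i)"
  proof (rule measure_finite_Union[symmetric, OF finite_ivals[OF assms] _ disj])
    show "J ` ivals P \<subseteq> sets lborel" by (auto simp: J_def)
    show "emeasure lborel (J i) \<noteq> \<infinity>" if "i \<in> ivals P" for i using le[OF that] by (simp add: J_def)
  qed
  also have "\<dots> \<le> measure lborel {0..T}"
  proof (rule measure_mono_fmeasurable)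
    have "J i \<subseteq> {0..T}" if "i \<in> ivals P" for i
      using ivalsD[OF assms, of "fst i" "snd i"] that by (auto simp: J_def)
    then show "(\<Union>i\<in>ivals P. J i) \<subseteq> {0..T}" by blast
    show "(\<Union>i\<in>ivals P. J i) \<in> sets lborel"
      using finite_ivals[OF assms] by (intro sets.finite_UN) (auto simp: J_def)
    show "{0..T} \<in> fmeasurable lborel" by (simp add: fmeasurable_def emeasure_lborel_Icc_eq)
  qed
  also have "\<dots> = T" using assms by (auto simp: partition_of_def)
  finally show ?thesis .
qed

text \<open>One factor \<open>v - u\<close> sums to at most \<open>T\<close>; the surplus power
  \<open>\<gamma> - 1 > 0\<close> is bounded by that of the mesh.\<close>

lemma sum_powr_ivals_tendsto_0:
  assumes part: "\<And>n. partition_of T (\<pi> n)" and mesh: "(\<lambda>n. mesh (\<pi> n)) \<longlonglongrightarrow> 0" and "\<gamma> > 1"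
  shows "(\<lambda>n. \<Sum>(u, v)\<in>ivals (\<pi> n). (v - u) powr \<gamma>) \<longlonglongrightarrow> 0"
proof (rule tendsto_sandwich[of "\<lambda>_. 0" _ _ "\<lambda>n. \<bar>mesh (\<pi> n)\<bar> powr (\<gamma> - 1) * T"])
  have "(\<Sum>(u, v)\<in>ivals (\<pi> n). (v - u) powr \<gamma>) \<le> \<bar>mesh (\<pi> n)\<bar> powr (\<gamma> - 1) * T" for n
  proof -
    have "(\<Sum>(u, v)\<in>ivals (\<pi> n). (v - u) powr \<gamma>)
        \<le> (\<Sum>(u, v)\<in>ivals (\<pi> n). \<bar>mesh (\<pi> n)\<bar> powr (\<gamma> - 1) * (v - u))"
    proof (rule sum_mono, clarify)
      fix u v assume uv: "(u, v) \<in> ivals (\<pi> n)"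
      have "u < v" "v - u \<le> mesh (\<pi> n)" using ivalsD(3)[OF part uv] ival_le_mesh[OF part uv] by auto
      then have "(v - u) powr (\<gamma> - 1) * (v - u) \<le> \<bar>mesh (\<pi> n)\<bar> powr (\<gamma> - 1) * (v - u)"
        using \<open>\<gamma> > 1\<close> by (intro mult_right_mono powr_mono2) auto
      moreover have "(v - u) powr (\<gamma> - 1) * (v - u) = (v - u) powr \<gamma>"
        using \<open>u < v\<close> powr_add[of "v - u" "\<gamma> - 1" 1] by simp
      ultimately show "(v - u) powr \<gamma> \<le> \<bar>mesh (\<pi> n)\<bar> powr (\<gamma> - 1) * (v - u)" by simp
    qed
    also have "\<dots> = \<bar>mesh (\<pi> n)\<bar> powr (\<gamma> - 1) * (\<Sum>(u, v)\<in>ivals (\<pi> n). v - u)"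
      by (simp add: sum_distrib_left split_def)
    also have "\<dots> \<le> \<bar>mesh (\<pi> n)\<bar> powr (\<gamma> - 1) * T"
      by (intro mult_left_mono sum_ivals_le part) simp
    finally show ?thesis .
  qed
  then show "\<forall>\<^sub>F n in sequentially.
      (\<Sum>(u, v)\<in>ivals (\<pi> n). (v - u) powr \<gamma>) \<le> \<bar>mesh (\<pi> n)\<bar> powr (\<gamma> - 1) * T"
    by simp
  have "(\<lambda>n. \<bar>mesh (\<pi> n)\<bar> powr (\<gamma> - 1) * T) \<longlonglongrightarrow> \<bar>0\<bar> powr (\<gamma> - 1) * T"
    using \<open>\<gamma> > 1\<close> by (intro tendsto_intros tendsto_powr' mesh) auto
  then show "(\<lambda>n. \<bar>mesh (\<pi> n)\<bar> powr (\<gamma> - 1) * T) \<longlonglongrightarrow> 0" by simp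
qed (auto intro!: always_eventually sum_nonneg)

lemma osc_tendsto_0:
  assumes "T > 0" and part: "\<And>n. partition_of T (\<pi> n)" and mesh: "(\<lambda>n. mesh (\<pi> n)) \<longlonglongrightarrow> 0"
    and modulus: "\<And>\<epsilon>. \<epsilon> > 0 \<Longrightarrow>
      \<exists>d>0. \<forall>x\<in>{0..T}. \<forall>y\<in>{0..T}. \<bar>x - y\<bar> < d \<longrightarrow> \<bar>f x - f y :: real\<bar> \<le> \<epsilon>"
  shows "(\<lambda>n. osc f (\<pi> n)) \<longlonglongrightarrow> 0"
proof (rule tendstoI)
  fix \<epsilon> :: real assume "\<epsilon> > 0"
  \<comment> \<open>Suprema preserve only weak inequalities, hence the margin.\<close>
  then have "\<epsilon> / 2 > 0" by simp
  from modulus[OF this] obtain d where "d > 0"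
    and d: "\<And>x y. x \<in> {0..T} \<Longrightarrow> y \<in> {0..T} \<Longrightarrow> \<bar>x - y\<bar> < d \<Longrightarrow> \<bar>f x - f y\<bar> \<le> \<epsilon> / 2" by blast
  have "\<forall>\<^sub>F n in sequentially. mesh (\<pi> n) < d"
    using mesh \<open>d > 0\<close> by (rule order_tendstoD(2))
  then show "\<forall>\<^sub>F n in sequentially. dist (osc f (\<pi> n)) 0 < \<epsilon>"
  proof eventually_elim
    case (elim n)
    define M where "M = (\<lambda>(u, v). SUP (r, s)\<in>{u..v} \<times> {u..v}. \<bar>f s - f r\<bar>)"
    have bound: "\<bar>f s - f r\<bar> \<le> \<epsilon> / 2"
      if "(u, v) \<in> ivals (\<pi> n)" "r \<in> {u..v}" "s \<in> {u..v}" for u v r s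
      using ivalsD[OF part that(1)] ival_le_mesh[OF part that(1)] that elim
      by (intro d) auto
    have M: "0 \<le> M i \<and> M i \<le> \<epsilon> / 2" if "i \<in> ivals (\<pi> n)" for i
    proof -
      obtain u v where i: "i = (u, v)" by fastforce
      have "u < v" using ivalsD[OF part] that i by blast
      have "M i \<le> \<epsilon> / 2"
        unfolding M_def i prod.case using bound that i \<open>u < v\<close> by (intro cSUP_least) auto
      moreover have "\<bar>f u - f u\<bar> \<le> M i"
        unfolding M_def i prod.case using bound that i \<open>u < v\<close>
        by (intro cSUP_upper2[where x = "(u, u)"] bdd_aboveI[of _ "\<epsilon> / 2"]) auto
      ultimately show ?thesis by simp
    qed
    \<comment> \<open>The maximum over finitely many intervals is attained, so the bounds on each
      \<open>M i\<close> pass to it.\<close>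
    have "osc f (\<pi> n) \<in> M ` ivals (\<pi> n)"
      unfolding osc_def M_def
      using finite_ivals[OF part] ivals_nonempty[OF part \<open>T > 0\<close>] by (intro Max_in) auto
    then show ?case using M \<open>\<epsilon> > 0\<close> by (auto simp: dist_real_def dest!: M)
  qed
qed

section \<open>Perturbation of sums of \<open>p\<close>-th powers\<close>

lemma abs_power_diff_le:
  fixes a b :: real
  assumes "\<bar>a\<bar> \<le> M" "\<bar>b\<bar> \<le> M"
  shows "\<bar>a ^ n - b ^ n\<bar> \<le> n * M ^ (n - 1) * \<bar>a - b\<bar>"
proof (cases n)
  case (Suc m)
  have "\<bar>\<Sum>i<Suc m. a ^ i * b ^ (m - i)\<bar> \<le> (\<Sum>i<Suc m. \<bar>a ^ i * b ^ (m - i)\<bar>)" by (rule sum_abs)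
  also have "\<dots> \<le> (\<Sum>i<Suc m. M ^ m)"
  proof (rule sum_mono)
    fix i assume "i \<in> {..<Suc m}"
    then have "M ^ m = M ^ i * M ^ (m - i)" by (simp add: power_add[symmetric])
    moreover have "\<bar>a\<bar> ^ i * \<bar>b\<bar> ^ (m - i) \<le> M ^ i * M ^ (m - i)"
      using assms by (intro mult_mono power_mono) auto
    ultimately show "\<bar>a ^ i * b ^ (m - i)\<bar> \<le> M ^ m" by (simp add: abs_mult power_abs)
  qed
  finally have "\<bar>\<Sum>i<Suc m. a ^ i * b ^ (m - i)\<bar> \<le> n * M ^ m" by (simp add: Suc)
  then have "\<bar>a - b\<bar> * \<bar>\<Sum>i<Suc m. a ^ i * b ^ (m - i)\<bar> \<le> \<bar>a - b\<bar> * (n * M ^ m)"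
    by (intro mult_left_mono) auto
  then show ?thesis
    using power_diff_sumr2[of a n b] Suc by (simp add: abs_mult mult_ac)
qed simp

text \<open>If \<open>a - b\<close> is small relative to \<open>b\<close>, the difference of the
  powers is a small multiple of \<open>\<bar>b\<bar> ^ n\<close>; otherwise \<open>a\<close> and
  \<open>b\<close> are both dominated by a multiple of \<open>a - b\<close>. Being pointwise, the
  inequality can be summed against bounded weights of either sign.\<close>

lemma abs_power_diff_le_split:
  fixes a b \<epsilon> :: real
  assumes "0 < \<epsilon>" "\<epsilon> \<le> 1" "n > 0"
  shows "\<bar>\<bar>a\<bar> ^ n - \<bar>b\<bar> ^ n\<bar> \<le> \<epsilon> * (real n * 2 ^ (n - 1) * \<bar>b\<bar> ^ n) + (1 + 1 / \<epsilon>) ^ n * \<bar>a - b\<bar> ^ n"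
proof (cases "\<bar>a - b\<bar> \<le> \<epsilon> * \<bar>b\<bar>")
  case True
  have "\<epsilon> * \<bar>b\<bar> \<le> \<bar>b\<bar>" using assms by (intro mult_left_le_one_le) auto
  then have "\<bar>a\<bar> \<le> 2 * \<bar>b\<bar>" using True by linarith
  then have "\<bar>\<bar>a\<bar> ^ n - \<bar>b\<bar> ^ n\<bar> \<le> n * (2 * \<bar>b\<bar>) ^ (n - 1) * \<bar>\<bar>a\<bar> - \<bar>b\<bar>\<bar>"
    by (intro abs_power_diff_le) auto
  also have "\<dots> \<le> n * (2 * \<bar>b\<bar>) ^ (n - 1) * (\<epsilon> * \<bar>b\<bar>)"
    using True by (intro mult_left_mono) auto
  also have "\<dots> = \<epsilon> * (real n * 2 ^ (n - 1) * \<bar>b\<bar> ^ n)"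
    by (subst power_minus_mult[OF \<open>n > 0\<close>, of "\<bar>b\<bar>", symmetric])
      (simp only: power_mult_distrib mult_ac)
  finally show ?thesis using assms by (simp add: add_increasing2)
next
  case False
  define R where "R = (1 + 1 / \<epsilon>) * \<bar>a - b\<bar>"
  have "\<bar>b\<bar> \<le> \<bar>a - b\<bar> / \<epsilon>" using False assms by (simp add: pos_le_divide_eq mult.commute)
  then have "\<bar>b\<bar> \<le> R" "\<bar>a\<bar> \<le> R" unfolding R_def by (auto simp: distrib_right)
  then have "\<bar>a\<bar> ^ n \<le> R ^ n" "\<bar>b\<bar> ^ n \<le> R ^ n" by (auto intro: power_mono)
  then have "\<bar>\<bar>a\<bar> ^ n - \<bar>b\<bar> ^ n\<bar> \<le> R ^ n"
    by (smt (verit) zero_le_power_abs power_abs zero_le_power abs_ge_zero)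
  also have "\<dots> = (1 + 1 / \<epsilon>) ^ n * \<bar>a - b\<bar> ^ n" by (simp add: R_def power_mult_distrib)
  finally show ?thesis using assms by (simp add: add_increasing)
qed

text \<open>The parameter \<open>\<epsilon>\<close> of the split is chosen first, so that the part
  proportional to \<open>\<bar>b i\<bar> ^ p\<close> stays below \<open>\<eta> / 2\<close> for all
  \<open>n\<close> by the bound \<open>B\<close>. With \<open>\<epsilon>\<close> fixed, the large
  constant in front of the other part is harmless in the limit.\<close>

lemma power_sums_perturbation:
  fixes a b \<phi> :: "'i \<Rightarrow> real" and I :: "nat \<Rightarrow> 'i set"
  assumes "p > 0" and \<phi>: "\<And>n i. i \<in> I n \<Longrightarrow> \<bar>\<phi> i\<bar> \<le> M" and "M \<ge> 0"
    and b: "\<And>n. (\<Sum>i\<in>I n. \<bar>b i\<bar> ^ p) \<le> B" and "B \<ge> 0"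
    and diff: "(\<lambda>n. \<Sum>i\<in>I n. \<bar>a i - b i\<bar> ^ p) \<longlonglongrightarrow> 0"
  shows "(\<lambda>n. (\<Sum>i\<in>I n. \<bar>a i\<bar> ^ p * \<phi> i) - (\<Sum>i\<in>I n. \<bar>b i\<bar> ^ p * \<phi> i)) \<longlonglongrightarrow> 0"
proof (rule tendstoI)
  fix \<eta> :: real assume "\<eta> > 0"
  define A where "A = M * (real p * 2 ^ (p - 1) * B)"
  have "A \<ge> 0" using assms by (simp add: A_def)
  define \<epsilon> where "\<epsilon> = min 1 (\<eta> / (2 * (A + 1)))"
  have \<epsilon>: "0 < \<epsilon>" "\<epsilon> \<le> 1" using \<open>\<eta> > 0\<close> \<open>A \<ge> 0\<close> by (auto simp: \<epsilon>_def)
  have \<epsilon>A: "\<epsilon> * A < \<eta> / 2"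
  proof -
    have "\<epsilon> \<le> \<eta> / (2 * (A + 1))" by (simp add: \<epsilon>_def)
    then have "\<epsilon> * (2 * (A + 1)) \<le> \<eta>" using \<open>A \<ge> 0\<close> by (simp add: pos_le_divide_eq)
    then show ?thesis using \<epsilon> by (simp add: algebra_simps)
  qed
  define E where "E = M * (1 + 1 / \<epsilon>) ^ p"
  have "(\<lambda>n. E * (\<Sum>i\<in>I n. \<bar>a i - b i\<bar> ^ p)) \<longlonglongrightarrow> E * 0" by (intro tendsto_intros diff)
  then have "\<forall>\<^sub>F n in sequentially. E * (\<Sum>i\<in>I n. \<bar>a i - b i\<bar> ^ p) < \<eta> / 2"
    using \<open>\<eta> > 0\<close> by (intro order_tendstoD(2)) auto
  then show "\<forall>\<^sub>F n in sequentially.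
      dist ((\<Sum>i\<in>I n. \<bar>a i\<bar> ^ p * \<phi> i) - (\<Sum>i\<in>I n. \<bar>b i\<bar> ^ p * \<phi> i)) 0 < \<eta>"
  proof eventually_elim
    case (elim n)
    have "\<bar>(\<Sum>i\<in>I n. \<bar>a i\<bar> ^ p * \<phi> i) - (\<Sum>i\<in>I n. \<bar>b i\<bar> ^ p * \<phi> i)\<bar>
        = \<bar>\<Sum>i\<in>I n. (\<bar>a i\<bar> ^ p - \<bar>b i\<bar> ^ p) * \<phi> i\<bar>"
      by (simp add: sum_subtractf left_diff_distrib)
    also have "\<dots> \<le> (\<Sum>i\<in>I n. \<bar>(\<bar>a i\<bar> ^ p - \<bar>b i\<bar> ^ p) * \<phi> i\<bar>)" by (rule sum_abs)
    also have "\<dots> \<le> (\<Sum>i\<in>I n. (\<epsilon> * (real p * 2 ^ (p - 1) * \<bar>b i\<bar> ^ p) +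
        (1 + 1 / \<epsilon>) ^ p * \<bar>a i - b i\<bar> ^ p) * M)"
    proof (rule sum_mono)
      fix i assume "i \<in> I n"
      then show "\<bar>(\<bar>a i\<bar> ^ p - \<bar>b i\<bar> ^ p) * \<phi> i\<bar> \<le>
          (\<epsilon> * (real p * 2 ^ (p - 1) * \<bar>b i\<bar> ^ p) + (1 + 1 / \<epsilon>) ^ p * \<bar>a i - b i\<bar> ^ p) * M"
        unfolding abs_mult[of _ "\<phi> i"] using \<epsilon>
        by (intro mult_mono[OF abs_power_diff_le_split[OF \<epsilon> \<open>p > 0\<close>] \<phi>]) auto
    qed
    also have "\<dots> = \<epsilon> * (M * (real p * 2 ^ (p - 1) * (\<Sum>i\<in>I n. \<bar>b i\<bar> ^ p))) +
        E * (\<Sum>i\<in>I n. \<bar>a i - b i\<bar> ^ p)"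
      by (simp add: E_def sum.distrib sum_distrib_left sum_distrib_right algebra_simps)
    also have "\<dots> \<le> \<epsilon> * A + E * (\<Sum>i\<in>I n. \<bar>a i - b i\<bar> ^ p)"
      unfolding A_def using \<epsilon> \<open>M \<ge> 0\<close> by (intro add_right_mono mult_left_mono b) auto
    also have "\<dots> < \<eta>" using elim \<epsilon>A by simp
    finally show ?case by (simp add: dist_real_def)
  qed
qed

section \<open>Weak limits of increment measures\<close>

lemma integral_increment_measure:
  assumes part: "partition_of T P" and "continuous_on {0..T} \<phi>"
  shows "integral\<^sup>L (increment_measure T p S P) \<phi> = (\<Sum>(u, v)\<in>ivals P. \<bar>S v - S u\<bar> ^ p * \<phi> u)"
proof -
  have "\<phi> \<in> borel_measurable (borel_upto T)"
    using assms(2) by (rule borel_measurable_continuous_on_restrict)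
  moreover have "fst \<in> measurable (point_measure (ivals P) (\<lambda>(u, v). ennreal (\<bar>S v - S u\<bar> ^ p)))
      (borel_upto T)"
    using ivalsD(1)[OF part] by (auto simp: space_restrict_space)
  ultimately have "integral\<^sup>L (increment_measure T p S P) \<phi> =
      integral\<^sup>L (point_measure (ivals P) (\<lambda>(u, v). ennreal (\<bar>S v - S u\<bar> ^ p))) (\<lambda>i. \<phi> (fst i))"
    unfolding increment_measure_def by (subst integral_distr) auto
  also have "(\<lambda>(u, v). ennreal (\<bar>S v - S u\<bar> ^ p)) = (\<lambda>i. ennreal (\<bar>S (snd i) - S (fst i)\<bar> ^ p))"
    by (simp add: split_def)
  also have "integral\<^sup>L (point_measure (ivals P) \<dots>) (\<lambda>i. \<phi> (fst i)) =
      (\<Sum>i\<in>ivals P. \<bar>S (snd i) - S (fst i)\<bar> ^ p *\<^sub>R \<phi> (fst i))"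
    by (rule lebesgue_integral_point_measure_finite[OF finite_ivals[OF part]]) simp
  finally show ?thesis by (simp add: split_def)
qed

text \<open>Continuous ramps converge pointwise to the indicator of \<open>{..t}\<close>, so the
  integrals of continuous functions determine the distribution function, and this determines the
  measure.\<close>

lemma finite_measure_eqI_continuous:
  assumes \<mu>: "sets \<mu> = sets (borel_upto T)" "finite_measure \<mu>"
    and \<nu>: "sets \<nu> = sets (borel_upto T)" "finite_measure \<nu>"
    and eq: "\<And>\<phi> :: real \<Rightarrow> real. continuous_on {0..T} \<phi> \<Longrightarrow> integral\<^sup>L \<mu> \<phi> = integral\<^sup>L \<nu> \<phi>"
  shows "\<mu> = \<nu>"
proof -
  have lim: "(\<lambda>k. \<integral>x. max 0 (1 - real k * max 0 (x - t)) \<partial>M) \<longlonglongrightarrow> measure M ({..t} \<inter> {0..T})"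
    if M: "sets M = sets (borel_upto T)" "finite_measure M" for M t
  proof -
    interpret finite_measure M by (rule M(2))
    have space: "space M = {0..T}" using sets_eq_imp_space_eq[OF M(1)] by (simp add: space_restrict_space)
    have meas: "\<phi> \<in> borel_measurable M" if "\<phi> \<in> borel_measurable borel" for \<phi> :: "real \<Rightarrow> real"
      using measurable_restrict_space1[OF that] measurable_cong_sets[OF M(1) refl] by blast
    have "(\<lambda>k. \<integral>x. max 0 (1 - real k * max 0 (x - t)) \<partial>M) \<longlonglongrightarrow> (\<integral>x. indicator {..t} x \<partial>M)"
    proof (rule integral_dominated_convergence[where w = "\<lambda>_. 1"])
      have "(\<lambda>k. max 0 (1 - real k * max 0 (x - t))) \<longlonglongrightarrow> indicator {..t} x" for x
      proof (cases "x \<le> t")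
        case False
        then obtain k0 :: nat where k0: "1 < real k0 * (x - t)"
          using ex_less_of_nat_mult[of "x - t" 1] by auto
        have "\<forall>\<^sub>F k in sequentially. max 0 (1 - real k * max 0 (x - t)) = 0"
          using eventually_ge_at_top[of k0]
        proof eventually_elim
          case (elim k)
          then have "real k0 * (x - t) \<le> real k * (x - t)"
            using False by (intro mult_right_mono) auto
          then have "1 - real k * (x - t) \<le> 0" using k0 by linarith
          then show ?case using False by (simp add: max_def)
        qed
        then show ?thesis using False by (simp add: tendsto_eventually)
      qed simp
      then show "AE x in M. (\<lambda>k. max 0 (1 - real k * max 0 (x - t))) \<longlonglongrightarrow> indicator {..t} x" by simp
      show "AE x in M. norm (max 0 (1 - real k * max 0 (x - t))) \<le> 1" for k by simp
    qed (auto intro!: meas)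
    also have "(\<integral>x. indicator {..t} x \<partial>M) = measure M ({..t} \<inter> {0..T})"
      using space by simp
    finally show ?thesis .
  qed
  have measure_eq: "measure \<mu> ({..t} \<inter> {0..T}) = measure \<nu> ({..t} \<inter> {0..T})" for t
  proof (rule LIMSEQ_unique[OF lim[OF \<mu>]])
    have "(\<integral>x. max 0 (1 - real k * max 0 (x - t)) \<partial>\<mu>) = (\<integral>x. max 0 (1 - real k * max 0 (x - t)) \<partial>\<nu>)" for k
      by (intro eq continuous_intros)
    then show "(\<lambda>k. \<integral>x. max 0 (1 - real k * max 0 (x - t)) \<partial>\<mu>) \<longlonglongrightarrow> measure \<nu> ({..t} \<inter> {0..T})"
      using lim[OF \<nu>, of t] by simp
  qed
  \<comment> \<open>\<open>cdf\<close> uniqueness concerns Borel measures on the whole line, so the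
    measures on \<open>{0..T}\<close> are first carried there by the inclusion.\<close>
  define push where "push M = distr M borel (\<lambda>x. x)" for M :: "real measure"
  have ident: "(\<lambda>x. x) \<in> measurable M borel" and space: "space M = {0..T}"
    if "sets M = sets (borel_upto T)" for M
  proof -
    have "(\<lambda>x. x) \<in> measurable (borel_upto T) borel" by (rule measurable_restrict_space1) simp
    then show "(\<lambda>x. x) \<in> measurable M borel" using measurable_cong_sets[OF that refl] by blast
    show "space M = {0..T}" using sets_eq_imp_space_eq[OF that] by (simp add: space_restrict_space)
  qed
  have fbm: "finite_borel_measure (push M)"
    if M: "sets M = sets (borel_upto T)" "finite_measure M" for M
    unfolding push_def finite_borel_measure_def finite_borel_measure_axioms_def
    using finite_measure.finite_measure_distr[OF M(2) ident[OF M(1)]] by simp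
  have "cdf (push M) t = measure M ({..t} \<inter> {0..T})" if "sets M = sets (borel_upto T)" for M t
    using ident[OF that] space[OF that] by (simp add: cdf_def push_def measure_distr vimage_def)
  then have "cdf (push \<mu>) = cdf (push \<nu>)" using \<mu> \<nu> measure_eq by auto
  from cdf_unique'[OF fbm[OF \<mu>] fbm[OF \<nu>] this] have push: "push \<mu> = push \<nu>" .
  show ?thesis
  proof (rule measure_eqI)
    fix A assume "A \<in> sets \<mu>"
    then have A: "A \<in> sets borel" "A \<subseteq> {0..T}"
      unfolding \<mu>(1) by (auto simp: sets_restrict_space)
    have "emeasure M A = emeasure (push M) A" if "sets M = sets (borel_upto T)" for M
      using ident[OF that] space[OF that] A
      by (simp add: push_def emeasure_distr Int_absorb2)
    then show "emeasure \<mu> A = emeasure \<nu> A" using \<mu> \<nu> push by simp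
  qed (use \<mu> \<nu> in simp)
qed

text \<open>Uniqueness of the weak limit justifies the definite description, so any measure with the
  defining property may be used to compute \<open>pvar\<close>.\<close>

lemma pvar_measure_eqI:
  assumes "is_pvar_measure T \<pi> p S \<mu>"
  shows "pvar_measure T \<pi> p S = \<mu>"
  unfolding pvar_measure_def
proof (rule the_equality)
  show "is_pvar_measure T \<pi> p S \<mu>" by (rule assms)
  fix \<nu> assume "is_pvar_measure T \<pi> p S \<nu>"
  with assms show "\<nu> = \<mu>"
    unfolding is_pvar_measure_def weakly_converges_on_def
    by (intro finite_measure_eqI_continuous) (auto intro: LIMSEQ_unique)
qed

text \<open>The functional enters here only through \<open>f\<close>, \<open>g\<close> and the
  remainder bound. The increments of \<open>f\<close> are \<open>g u * (S v - S u)\<close> up to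
  remainders whose \<open>p\<close>-th powers sum to at most a multiple of the sum of
  \<open>(v - u) powr (\<beta> * p)\<close>, which vanishes in the limit because
  \<open>\<beta> * p > 1\<close>.\<close>

lemma is_pvar_measure_density:
  fixes f g :: "real \<Rightarrow> real" and \<beta> h0 C :: real
  assumes "T > 0" "p > 0"
    and part: "\<And>n. partition_of T (\<pi> n)" and mesh: "(\<lambda>n. mesh (\<pi> n)) \<longlonglongrightarrow> 0"
    and \<mu>: "is_pvar_measure T \<pi> p S \<mu>"
    and g: "continuous_on {0..T} g"
    and "\<beta> * p > 1" "h0 > 0" "C \<ge> 0"
    and rem: "\<And>s t. s \<in> {0..T} \<Longrightarrow> t \<in> {0..T} \<Longrightarrow> s < t \<Longrightarrow> t - s \<le> h0 \<Longrightarrow>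
      \<bar>f t - f s - g s * (S t - S s)\<bar> \<le> C * (t - s) powr \<beta>"
  shows "is_pvar_measure T \<pi> p f (density \<mu> (\<lambda>s. ennreal (\<bar>g s\<bar> ^ p)))"
proof -
  define G where "G s = \<bar>g s\<bar> ^ p" for s
  define \<nu> where "\<nu> = density \<mu> (\<lambda>s. ennreal (G s))"
  have sets_\<mu>: "sets \<mu> = sets (borel_upto T)" and fin_\<mu>: "finite_measure \<mu>"
    and atoms: "\<And>x. x \<in> {0..T} \<Longrightarrow> emeasure \<mu> {x} = 0"
    and weak: "\<And>\<phi> :: real \<Rightarrow> real. continuous_on {0..T} \<phi> \<Longrightarrow>
      (\<lambda>n. integral\<^sup>L (increment_measure T p S (\<pi> n)) \<phi>) \<longlonglongrightarrow> integral\<^sup>L \<mu> \<phi>"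
    using \<mu> by (auto simp: is_pvar_measure_def weakly_converges_on_def)
  interpret finite_measure \<mu> by (rule fin_\<mu>)
  have space_\<mu>: "space \<mu> = {0..T}"
    using sets_eq_imp_space_eq[OF sets_\<mu>] by (simp add: space_restrict_space)
  have meas: "\<phi> \<in> borel_measurable \<mu>" if "continuous_on {0..T} \<phi>" for \<phi> :: "real \<Rightarrow> real"
    using borel_measurable_continuous_on_restrict[OF that] measurable_cong_sets[OF sets_\<mu> refl] by blast
  have bounded: "\<exists>B\<ge>0. \<forall>x\<in>{0..T}. \<bar>\<phi> x\<bar> \<le> B" if "continuous_on {0..T} \<phi>" for \<phi> :: "real \<Rightarrow> real"
  proof -
    have "compact (\<phi> ` {0..T})" using that by (intro compact_continuous_image) auto
    then obtain B where "B > 0" "\<forall>y\<in>\<phi> ` {0..T}. \<bar>y\<bar> \<le> B"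
      by (auto dest!: compact_imp_bounded simp: bounded_pos)
    then show ?thesis by (intro exI[of _ B]) auto
  qed
  have G_cont: "continuous_on {0..T} G" unfolding G_def by (intro continuous_intros g)
  have G_nonneg: "G x \<ge> 0" for x by (simp add: G_def)
  have integrable: "integrable \<mu> \<phi>" if \<phi>: "continuous_on {0..T} \<phi>" for \<phi> :: "real \<Rightarrow> real"
  proof -
    obtain B where B: "\<forall>x\<in>{0..T}. \<bar>\<phi> x\<bar> \<le> B" using bounded[OF \<phi>] by blast
    show ?thesis
      by (rule integrable_const_bound[of _ B]) (use B space_\<mu> meas[OF \<phi>] in auto)
  qed
  have "finite_measure \<nu>"
  proof
    have "emeasure \<nu> (space \<nu>) = (\<integral>\<^sup>+ x. ennreal (G x) \<partial>\<mu>)"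
      unfolding \<nu>_def using meas[OF G_cont]
      by (subst emeasure_density) (auto intro!: nn_integral_cong)
    also have "\<dots> = ennreal (\<integral>x. G x \<partial>\<mu>)"
      using integrable[OF G_cont] G_nonneg by (intro nn_integral_eq_integral) auto
    finally show "emeasure \<nu> (space \<nu>) \<noteq> \<infinity>" by simp
  qed
  moreover have "emeasure \<nu> {x} = 0" if "x \<in> {0..T}" for x
  proof -
    have "{x} \<in> sets \<mu>" unfolding sets_\<mu> using that by (auto simp: sets_restrict_space)
    then have "{x} \<in> null_sets \<mu>" using atoms[OF that] by auto
    then have "{x} \<in> null_sets \<nu>"
      unfolding \<nu>_def using meas[OF G_cont]
      by (intro absolutely_continuousI_density[unfolded absolutely_continuous_def, THEN subsetD]) auto
    then show ?thesis by auto
  qed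
  moreover have "weakly_converges_on T (\<lambda>n. increment_measure T p f (\<pi> n)) \<nu>"
    unfolding weakly_converges_on_def
  proof (intro allI impI)
    fix \<phi> :: "real \<Rightarrow> real" assume \<phi>: "continuous_on {0..T} \<phi>"
    define I where "I n = ivals (\<pi> n)" for n
    define a where "a = (\<lambda>(u, v). f v - f u)"
    define b where "b = (\<lambda>(u, v). g u * (S v - S u))"
    obtain M where M: "M \<ge> 0" "\<forall>x\<in>{0..T}. \<bar>\<phi> x\<bar> \<le> M" using bounded[OF \<phi>] by blast
    \<comment> \<open>The increment measure places its mass at the left endpoint, where the
      expansion evaluates \<open>g\<close>. Hence the weight \<open>\<bar>g\<bar>^p\<close> simply
      becomes part of the test function.\<close>
    have b_sum: "(\<Sum>i\<in>I n. \<bar>b i\<bar> ^ p * \<psi> (fst i)) =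
        integral\<^sup>L (increment_measure T p S (\<pi> n)) (\<lambda>x. G x * \<psi> x)"
      if "continuous_on {0..T} \<psi>" for n and \<psi> :: "real \<Rightarrow> real"
      unfolding I_def b_def
      by (subst integral_increment_measure[OF part])
        (auto intro!: continuous_intros G_cont g that sum.cong
          simp: G_def abs_mult power_mult_distrib mult_ac split_def)
    have a_sum: "(\<Sum>i\<in>I n. \<bar>a i\<bar> ^ p * \<phi> (fst i)) =
        integral\<^sup>L (increment_measure T p f (\<pi> n)) \<phi>" for n
      unfolding I_def a_def by (subst integral_increment_measure[OF part \<phi>]) (simp add: split_def)
    \<comment> \<open>The constant test function \<open>1\<close> gives convergence of these sums,
      hence the uniform bound \<open>B\<close> required by the perturbation lemma.\<close>
    have "(\<lambda>n. \<Sum>i\<in>I n. \<bar>b i\<bar> ^ p * 1) \<longlonglongrightarrow> integral\<^sup>L \<mu> (\<lambda>x. G x * 1)"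
      using weak[of "\<lambda>x. G x * 1"] G_cont by (subst b_sum) auto
    then have "Bseq (\<lambda>n. \<Sum>i\<in>I n. \<bar>b i\<bar> ^ p)" by (intro convergent_imp_Bseq convergentI) auto
    then obtain B where "B > 0" and B: "\<And>n. \<bar>\<Sum>i\<in>I n. \<bar>b i\<bar> ^ p\<bar> \<le> B"
      by (auto simp: Bseq_def)
    have "(\<lambda>n. \<Sum>i\<in>I n. \<bar>a i - b i\<bar> ^ p) \<longlonglongrightarrow> 0"
    proof (rule tendsto_sandwich[of "\<lambda>_. 0" _ _
          "\<lambda>n. C ^ p * (\<Sum>(u, v)\<in>ivals (\<pi> n). (v - u) powr (\<beta> * p))"])
      have "\<forall>\<^sub>F n in sequentially. mesh (\<pi> n) < h0"
        using mesh \<open>h0 > 0\<close> by (rule order_tendstoD(2))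
      then show "\<forall>\<^sub>F n in sequentially. (\<Sum>i\<in>I n. \<bar>a i - b i\<bar> ^ p)
          \<le> C ^ p * (\<Sum>(u, v)\<in>ivals (\<pi> n). (v - u) powr (\<beta> * p))"
      proof eventually_elim
        case (elim n)
        have "(\<Sum>i\<in>I n. \<bar>a i - b i\<bar> ^ p)
            \<le> (\<Sum>(u, v)\<in>ivals (\<pi> n). C ^ p * (v - u) powr (\<beta> * p))"
          unfolding I_def
        proof (rule sum_mono, clarify)
          fix u v assume uv: "(u, v) \<in> ivals (\<pi> n)"
          have "\<bar>f v - f u - g u * (S v - S u)\<bar> \<le> C * (v - u) powr \<beta>"
            using ivalsD[OF part uv] ival_le_mesh[OF part uv] elim by (intro rem) auto
          then have "\<bar>a (u, v) - b (u, v)\<bar> ^ p \<le> (C * (v - u) powr \<beta>) ^ p"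
            unfolding a_def b_def by (intro power_mono) auto
          also have "\<dots> = C ^ p * (v - u) powr (\<beta> * p)"
            using ivalsD(3)[OF part uv]
            by (simp add: power_mult_distrib powr_powr[symmetric] powr_realpow)
          finally show "\<bar>a (u, v) - b (u, v)\<bar> ^ p \<le> C ^ p * (v - u) powr (\<beta> * p)" .
        qed
        then show ?case by (simp add: sum_distrib_left split_def)
      qed
      have "(\<lambda>n. C ^ p * (\<Sum>(u, v)\<in>ivals (\<pi> n). (v - u) powr (\<beta> * p))) \<longlonglongrightarrow> C ^ p * 0"
        by (intro tendsto_mult tendsto_const sum_powr_ivals_tendsto_0[OF part mesh] \<open>\<beta> * p > 1\<close>)
      then show "(\<lambda>n. C ^ p * (\<Sum>(u, v)\<in>ivals (\<pi> n). (v - u) powr (\<beta> * p))) \<longlonglongrightarrow> 0"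
        by simp
    qed (auto intro!: always_eventually sum_nonneg)
    then have "(\<lambda>n. (\<Sum>i\<in>I n. \<bar>a i\<bar> ^ p * \<phi> (fst i)) - (\<Sum>i\<in>I n. \<bar>b i\<bar> ^ p * \<phi> (fst i))) \<longlonglongrightarrow> 0"
    proof (rule power_sums_perturbation[OF \<open>p > 0\<close> _ M(1) _ less_imp_le[OF \<open>B > 0\<close>], rotated 2])
      fix n i assume "i \<in> I n"
      then show "\<bar>\<phi> (fst i)\<bar> \<le> M" using M(2) ivalsD(1)[OF part, of "fst i" "snd i"] by (simp add: I_def)
    next
      fix n show "(\<Sum>i\<in>I n. \<bar>b i\<bar> ^ p) \<le> B" using B[of n] by simp
    qed
    moreover have "(\<lambda>n. \<Sum>i\<in>I n. \<bar>b i\<bar> ^ p * \<phi> (fst i)) \<longlonglongrightarrow> integral\<^sup>L \<mu> (\<lambda>x. G x * \<phi> x)"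
      unfolding b_sum[OF \<phi>] by (intro weak continuous_intros G_cont \<phi>)
    ultimately have "(\<lambda>n. integral\<^sup>L (increment_measure T p f (\<pi> n)) \<phi>)
        \<longlonglongrightarrow> 0 + integral\<^sup>L \<mu> (\<lambda>x. G x * \<phi> x)"
      unfolding a_sum using tendsto_add by fastforce
    moreover have "integral\<^sup>L \<nu> \<phi> = integral\<^sup>L \<mu> (\<lambda>x. G x * \<phi> x)"
      unfolding \<nu>_def using meas[OF G_cont] meas[OF \<phi>] G_nonneg by (subst integral_density) auto
    ultimately show "(\<lambda>n. integral\<^sup>L (increment_measure T p f (\<pi> n)) \<phi>) \<longlonglongrightarrow> integral\<^sup>L \<nu> \<phi>"
      by simp
  qed
  ultimately show ?thesis
    unfolding is_pvar_measure_def using sets_\<mu> by (simp add: \<nu>_def G_def)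
qed

text \<open>Integrability is recorded along with the formula because the integral of a
  non-integrable function is \<open>0\<close> by convention, so the equation alone would say
  less.\<close>

lemma measure_density_continuous:
  assumes "sets \<mu> = sets (borel_upto T)" "finite_measure \<mu>" and "t \<le> T"
    and G: "continuous_on {0..T} G" "\<And>x. G x \<ge> 0"
  shows "set_integrable \<mu> {0..t} G"
    and "measure (density \<mu> (\<lambda>s. ennreal (G s))) {0..t} = (LINT s:{0..t}|\<mu>. G s)"
proof -
  interpret finite_measure \<mu> by fact
  have space: "space \<mu> = {0..T}"
    using sets_eq_imp_space_eq[OF assms(1)] by (simp add: space_restrict_space)
  have A: "{0..t} \<in> sets \<mu>" unfolding assms(1) using \<open>t \<le> T\<close> by (auto simp: sets_restrict_space)
  have meas: "G \<in> borel_measurable \<mu>"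
    using borel_measurable_continuous_on_restrict[OF G(1)] measurable_cong_sets[OF assms(1) refl] by blast
  have "compact (G ` {0..T})" using G(1) by (intro compact_continuous_image) auto
  then obtain B where B: "\<forall>y\<in>G ` {0..T}. \<bar>y\<bar> \<le> B"
    by (auto dest!: compact_imp_bounded simp: bounded_pos)
  have "integrable \<mu> G"
    by (rule integrable_const_bound[of _ B]) (use B space meas in auto)
  then show int: "set_integrable \<mu> {0..t} G"
    unfolding set_integrable_def using A by (rule integrable_mult_indicator[rotated])
  have "emeasure (density \<mu> (\<lambda>s. ennreal (G s))) {0..t} =
      (\<integral>\<^sup>+ s. ennreal (indicator {0..t} s *\<^sub>R G s) \<partial>\<mu>)"
    using A meas by (subst emeasure_density) (auto intro!: nn_integral_cong simp: indicator_def)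
  also have "\<dots> = ennreal (LINT s:{0..t}|\<mu>. G s)"
    unfolding set_lebesgue_integral_def using int G(2)
    by (intro nn_integral_eq_integral) (auto simp: set_integrable_def)
  finally show "measure (density \<mu> (\<lambda>s. ennreal (G s))) {0..t} = (LINT s:{0..t}|\<mu>. G s)"
    using G(2) by (simp add: measure_def set_lebesgue_integral_def integral_nonneg_AE)
qed

theorem theorem2p1:
  fixes T \<alpha> :: real and p :: nat and \<pi> :: "nat \<Rightarrow> real set"
    and S :: "real \<Rightarrow> real" and F :: functional
  assumes "T > 0"
    and "even p" and "p \<ge> 2"
    and "0 < \<alpha>" and "\<alpha> < 1" and "\<alpha> > (sqrt (1 + 4 / real p) - 1) / 2"
    and "\<And>n. partition_of T (\<pi> n)" and "(\<lambda>n. mesh (\<pi> n)) \<longlonglongrightarrow> 0"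
    and "S \<in> Vp T \<pi> p \<inter> holder_paths T \<alpha>"
    and "F \<in> C1b T 2" and "vderiv T F \<in> C1b T 1"
    and "d_inf_lipschitz T F"
  shows "(\<lambda>t. F t (stopped T t S)) \<in> Vp T \<pi> p \<and>
    (\<forall>t\<in>{0..T}.
       set_integrable (pvar_measure T \<pi> p S) {0..t} (\<lambda>s. \<bar>vderiv T F s (stopped T s S)\<bar> ^ p) \<and>
       pvar T \<pi> p (\<lambda>t. F t (stopped T t S)) t =
         (LINT s:{0..t}|pvar_measure T \<pi> p S. \<bar>vderiv T F s (stopped T s S)\<bar> ^ p))"
proof -
  obtain \<mu> where \<mu>: "is_pvar_measure T \<pi> p S \<mu>" and S_cont: "continuous_on {0..T} S"
    using assms(9) by (auto simp: Vp_def)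
  obtain C0 where C0: "\<And>x y. x \<in> {0..T} \<Longrightarrow> y \<in> {0..T} \<Longrightarrow> \<bar>S x - S y\<bar> \<le> C0 * \<bar>x - y\<bar> powr \<alpha>"
    using assms(9) unfolding holder_paths_def by blast
  \<comment> \<open>\<open>S\<close> is arbitrary off \<open>{0..T}\<close>, whereas members of
    \<open>cadlag_paths T\<close> are \<open>undefined\<close> there. The restriction has the same
    stopped paths.\<close>
  define U where "U = restrict S {0..T}"
  have U: "U \<in> cadlag_paths T" unfolding U_def by (rule continuous_cadlag[OF S_cont])
  have U_cont: "continuous_on {0..T} U" using S_cont by (rule continuous_on_eq) (simp add: U_def)
  have stopped_U: "stopped T t U = stopped T t S" if "t \<in> {0..T}" for t
    using that by (intro stopped_cong) (auto simp: U_def)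
  define G where "G = vderiv T F"
  have F: "F \<in> C00l T" "vertically_differentiable T F"
    using assms(10) by (auto simp: C1b_def dest: spec[of _ 0])
  have G: "G \<in> C00l T" "vertically_differentiable T G" "horizontally_differentiable T G"
    using assms(11) by (auto simp: C1b_def G_def)
  have DG: "hderiv T G \<in> C00l T" "hderiv T G \<in> boundedness_preserving T"
    and VG: "vderiv T G \<in> C00l T" "vderiv T G \<in> boundedness_preserving T"
    using assms(11) by (auto simp: C1b_def G_def)
  obtain L where L: "L \<ge> 0" "\<forall>(t, \<omega>)\<in>Lambda T. \<forall>(t', \<omega>')\<in>Lambda T.
      \<bar>F t \<omega> - F t' \<omega>'\<bar> \<le> L * d_inf T (t, \<omega>) (t', \<omega>')"
    using assms(12) by (auto simp: d_inf_lipschitz_def)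
  obtain \<delta>1 K1 where 1: "\<delta>1 > 0" "K1 \<ge> 0" "\<And>t \<omega>. t \<in> {0..T} \<Longrightarrow> \<omega> \<in> tube T U \<delta>1 t \<Longrightarrow>
      \<bar>vderiv T G t (stopped T t \<omega>)\<bar> \<le> K1"
    using bounded_on_tube[OF assms(1) VG U U_cont] by metis
  obtain \<delta>2 K2 where 2: "\<delta>2 > 0" "K2 \<ge> 0" "\<And>t \<omega>. t \<in> {0..T} \<Longrightarrow> \<omega> \<in> tube T U \<delta>2 t \<Longrightarrow>
      \<bar>hderiv T G t (stopped T t \<omega>)\<bar> \<le> K2"
    using bounded_on_tube[OF assms(1) DG U U_cont] by metis
  \<comment> \<open>Tubes shrink with their radius, so the smaller radius and the larger constant
    serve both derivatives.\<close>
  interpret lipschitz_functional T U F G L "max K1 K2" "min \<delta>1 \<delta>2"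
  proof
    fix t \<omega> assume "t \<in> {0..T}" "\<omega> \<in> tube T U (min \<delta>1 \<delta>2) t"
    then show "\<bar>vderiv T G t (stopped T t \<omega>)\<bar> \<le> max K1 K2"
      and "\<bar>hderiv T G t (stopped T t \<omega>)\<bar> \<le> max K1 K2"
      using 1(3)[of t \<omega>] 2(3)[of t \<omega>] by (auto simp: tube_def)
  qed (use assms(1) U U_cont F G L 1 2 in \<open>auto simp: G_def\<close>)
  define f where "f t = F t (stopped T t S)" for t
  define g where "g t = vderiv T F t (stopped T t S)" for t
  have fU: "F t (stopped T t U) = f t" and gU: "G t (stopped T t U) = g t" if "t \<in> {0..T}" for t
    using stopped_U[OF that] by (simp_all add: f_def g_def G_def)
  have f_cont: "continuous_on {0..T} f" and g_cont: "continuous_on {0..T} g"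
    using continuous_on_eq[OF f_continuous fU] continuous_on_eq[OF g_continuous gU] by auto
  \<comment> \<open>The cap at \<open>1\<close> reflects the terms of order \<open>t - s\<close>
    left by the passage of time; in that case \<open>\<beta> * p > 1\<close> holds by
    \<open>p \<ge> 2\<close>. The other case amounts to \<open>\<alpha>\<close> exceeding the
    positive root of \<open>x * x + x = 1 / p\<close>.\<close>
  define \<beta> where "\<beta> = min 1 (\<alpha> + \<alpha>\<^sup>2)"
  have "\<beta> * p > 1"
  proof -
    have "sqrt (1 + 4 / p) < 2 * \<alpha> + 1" using assms(6) by simp
    then have "(sqrt (1 + 4 / p))\<^sup>2 < (2 * \<alpha> + 1)\<^sup>2" by (rule power_strict_mono) auto
    then have "1 + 4 / p < (2 * \<alpha> + 1)\<^sup>2" by simp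
    then have "1 / p < \<alpha> + \<alpha>\<^sup>2" by (simp add: power2_eq_square algebra_simps)
    then have "1 < (\<alpha> + \<alpha>\<^sup>2) * p" using assms(3) by (simp add: field_simps)
    then show ?thesis using assms(3) by (simp add: \<beta>_def min_def)
  qed
  \<comment> \<open>A Hoelder constant may be zero or negative, while the choice of
    \<open>h0\<close> divides by it; \<open>\<bar>C0\<bar> + 1\<close> is a positive
    substitute.\<close>
  have holder: "\<bar>U x - U y\<bar> \<le> (\<bar>C0\<bar> + 1) * \<bar>x - y\<bar> powr \<alpha>" if "x \<in> {0..T}" "y \<in> {0..T}" for x y
  proof -
    have "C0 * \<bar>x - y\<bar> powr \<alpha> \<le> (\<bar>C0\<bar> + 1) * \<bar>x - y\<bar> powr \<alpha>" by (intro mult_right_mono) auto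
    then show ?thesis using C0[OF that] that by (simp add: U_def)
  qed
  obtain h0 C where "h0 > 0" "C \<ge> 0" and rem: "\<And>s t. s \<in> {0..T} \<Longrightarrow> t \<in> {0..T} \<Longrightarrow> s < t \<Longrightarrow>
      t - s \<le> h0 \<Longrightarrow> \<bar>f t - f s - g s * (S t - S s)\<bar> \<le> C * (t - s) powr \<beta>"
  proof (rule remainder_bound[of \<alpha> \<beta> "\<bar>C0\<bar> + 1"])
    fix h0 C :: real
    assume "h0 > 0" "C \<ge> 0" and est: "\<And>s t. s \<in> {0..T} \<Longrightarrow> t \<in> {0..T} \<Longrightarrow> s < t \<Longrightarrow> t - s \<le> h0 \<Longrightarrow>
      \<bar>F t (stopped T t U) - F s (stopped T s U) - G s (stopped T s U) * (U t - U s)\<bar>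
        \<le> C * (t - s) powr \<beta>"
    show thesis
    proof (rule that[OF \<open>h0 > 0\<close> \<open>C \<ge> 0\<close>])
      fix s t assume st: "s \<in> {0..T}" "t \<in> {0..T}" "s < t" "t - s \<le> h0"
      have "U s = S s" "U t = S t" using st by (simp_all add: U_def)
      then show "\<bar>f t - f s - g s * (S t - S s)\<bar> \<le> C * (t - s) powr \<beta>"
        using est[OF st] by (simp add: fU[OF st(1)] fU[OF st(2)] gU[OF st(1)])
    qed
  qed (use assms(4,5) holder in \<open>auto simp: \<beta>_def\<close>)
  define \<nu> where "\<nu> = density \<mu> (\<lambda>s. ennreal (\<bar>g s\<bar> ^ p))"
  have "p > 0" using assms(3) by simp
  have \<nu>: "is_pvar_measure T \<pi> p f \<nu>"
    unfolding \<nu>_def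
    by (rule is_pvar_measure_density[OF assms(1) \<open>p > 0\<close> assms(7,8) \<mu> g_cont \<open>\<beta> * p > 1\<close>
          \<open>h0 > 0\<close> \<open>C \<ge> 0\<close> rem])
  have "(\<lambda>n. osc f (\<pi> n)) \<longlonglongrightarrow> 0"
  proof (rule osc_tendsto_0[OF assms(1,7,8)])
    fix \<epsilon> :: real assume "\<epsilon> > 0"
    from f_modulus[OF this] show "\<exists>d>0. \<forall>x\<in>{0..T}. \<forall>y\<in>{0..T}. \<bar>x - y\<bar> < d \<longrightarrow> \<bar>f x - f y\<bar> \<le> \<epsilon>"
      by (metis fU)
  qed
  then have "f \<in> Vp T \<pi> p" using f_cont \<nu> by (auto simp: Vp_def)
  moreover have "set_integrable \<mu> {0..t} (\<lambda>s. \<bar>g s\<bar> ^ p) \<and>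
      measure \<nu> {0..t} = (LINT s:{0..t}|\<mu>. \<bar>g s\<bar> ^ p)" if "t \<in> {0..T}" for t
  proof -
    have "continuous_on {0..T} (\<lambda>s. \<bar>g s\<bar> ^ p)" by (intro continuous_intros g_cont)
    then show ?thesis
      using \<mu> that measure_density_continuous[of \<mu> T t "\<lambda>s. \<bar>g s\<bar> ^ p"]
      by (simp add: \<nu>_def is_pvar_measure_def)
  qed
  ultimately show ?thesis
    using pvar_measure_eqI[OF \<mu>] pvar_measure_eqI[OF \<nu>]
    by (simp add: pvar_def f_def[abs_def] g_def[abs_def])
qed

end
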